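(* Let $n\ge 1$, let $D\in M(n,\mathbb R)$ have characteristic roots $d_1,\dots,d_n$ with $-\tfrac12<\Re(d_k)<\tfrac12$ for all $k$, and let $A\in M(n,\mathbb C)$ be such that $\Re(AA^* )$ has full rank (equivalently, is positive definite). Let $B_H$ be the OFBM with spectral parametrization $(D,A)$. Then $B_H$ is of maximal type if and only if there exists a real number $d$ such that $$\Im(AA^* )=0\quad\text{and}\quad -(D-dI)\,\Re(AA^* )=\Re(AA^* )\,(D^*-dI).$$ Moreover, if $B_H$ is of maximal type, then it is a single parameter OFBM up to conjugacy by a positive definite matrix: there exist a positive definite $W\in M(n,\mathbb R)$ and a single parameter OFBM $X$ such that $\{B_H(t)\}_{t\in\mathbb R}\overset{fdd}{=}\{WX(t)\}_{t\in\mathbb R}$.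
   Context: For $D\in M(n,\mathbb R)$ whose characteristic roots have real parts in $(-\tfrac12,\tfrac12)$ and $A\in M(n,\mathbb C)$, the operator fractional Brownian motion (OFBM) with spectral parametrization $(D,A)$ is the zero-mean $\mathbb R^n$-valued Gaussian process $$B_H(t)=\int_{\mathbb R}\frac{e^{itx}-1}{ix}\big(x_+^{-D}A+x_-^{-D}\overline{A}\big)\,\tilde B(dx),\quad t\in\mathbb R,$$ where $H=D+\tfrac12 I$ is its (Hurst) exponent, $x_\pm=\max\{\pm x,0\}$, $x^{-D}=\exp(-D\log x)$ for $x>0$ (and $0^{-D}:=0$), and $\tilde B$ is a $\mathbb C^n$-valued Gaussian random measure with $\tilde B(-dx)=\overline{\tilde B(dx)}$ and $E\,\tilde B(dx)\tilde B(dx)^*=dx$. Here $\Re$, $\Im$ denote entrywise real and imaginary parts and $^*$ the conjugate transpose. The symmetry group of a process $X$ is $G_X=\{C\in GL(n,\mathbb R):\{CX(t)\}_t\overset{fdd}{=}\{X(t)\}_t\}$ ($\overset{fdd}{=}$: equality of finite-dimensional distributions). $X$ is of maximal type if $G_X=W\,O(n)\,W^{-1}$ for some positive definite $W$, where $O(n)$ is the orthogonal group. A single parameter OFBM is a process $X=(X_1,\dots,X_n)$ whose components are independent fractional Brownian motions with a common Hurst parameter $h\in(0,1)$ and a common variance, i.e. $EX(t)X(s)^*=\frac{c}{2}(|t|^{2h}+|s|^{2h}-|t-s|^{2h})\,I$ for some $c>0$. *)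

theory Defs
  imports "HOL-Analysis.Analysis" "HOL-Probability.Probability"
begin

definition mpow :: "'a::semiring_1^'n^'n \<Rightarrow> nat \<Rightarrow> 'a^'n^'n" where
  "mpow M k = ((\<lambda>X. M ** X) ^^ k) (mat 1)"

definition mexp :: "real^'n^'n \<Rightarrow> real^'n^'n" where
  "mexp M = (\<Sum>k. (1 / fact k) *\<^sub>R mpow M k)"

definition mpowr_neg :: "real \<Rightarrow> real^'n^'n \<Rightarrow> real^'n^'n" where
  "mpowr_neg x D = (if x > 0 then mexp (- (ln x *\<^sub>R D)) else 0)"

definition cmat :: "real^'n^'m \<Rightarrow> complex^'n^'m" where
  "cmat M = (\<chi> i j. complex_of_real (M $ i $ j))"

definition mconj :: "complex^'n^'m \<Rightarrow> complex^'n^'m" where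
  "mconj M = (\<chi> i j. cnj (M $ i $ j))"

definition adjoint_mat :: "complex^'n^'m \<Rightarrow> complex^'m^'n" where
  "adjoint_mat M = transpose (mconj M)"

definition mRe :: "complex^'n^'m \<Rightarrow> real^'n^'m" where
  "mRe M = (\<chi> i j. Re (M $ i $ j))"

definition mIm :: "complex^'n^'m \<Rightarrow> real^'n^'m" where
  "mIm M = (\<chi> i j. Im (M $ i $ j))"

definition char_roots :: "real^'n^'n \<Rightarrow> complex set" where
  "char_roots D = {z. det (mat z - cmat D) = 0}"

definition pos_def :: "real^'n^'n \<Rightarrow> bool" where
  "pos_def W \<longleftrightarrow> transpose W = W \<and> (\<forall>x. x \<noteq> 0 \<longrightarrow> x \<bullet> (W *v x) > 0)"

definition ofbm_kernel :: "real^'n^'n \<Rightarrow> complex^'n^'n \<Rightarrow> real \<Rightarrow> complex^'n^'n" where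
  "ofbm_kernel D A x =
     cmat (mpowr_neg (max x 0) D) ** A + cmat (mpowr_neg (max (-x) 0) D) ** mconj A"

definition ofbm_transfer :: "real \<Rightarrow> real \<Rightarrow> complex" where
  "ofbm_transfer t x = (exp (\<i> * complex_of_real (t * x)) - 1) / (\<i> * complex_of_real x)"

definition ofbm_cov :: "real^'n^'n \<Rightarrow> complex^'n^'n \<Rightarrow> real \<Rightarrow> real \<Rightarrow> complex^'n^'n" where
  "ofbm_cov D A t s = (\<chi> i j. LINT x|lborel.
       ofbm_transfer t x * cnj (ofbm_transfer s x) *
       ((ofbm_kernel D A x ** adjoint_mat (ofbm_kernel D A x)) $ i $ j))"

definition centered_gaussian_rv :: "'a measure \<Rightarrow> ('a \<Rightarrow> real) \<Rightarrow> bool" where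
  "centered_gaussian_rv M Y \<longleftrightarrow> Y \<in> borel_measurable M \<and>
     ((AE \<omega> in M. Y \<omega> = 0) \<or> (\<exists>\<sigma>>0. distributed M lborel Y (normal_density 0 \<sigma>)))"

definition centered_gaussian_process :: "'a measure \<Rightarrow> (real \<Rightarrow> 'a \<Rightarrow> real^'n) \<Rightarrow> bool" where
  "centered_gaussian_process M X \<longleftrightarrow>
     (\<forall>t. X t \<in> borel_measurable M) \<and>
     (\<forall>ts :: real list. \<forall>cs :: (real^'n) list. length cs = length ts \<longrightarrow>
        centered_gaussian_rv M (\<lambda>\<omega>. \<Sum>k<length ts. (cs ! k) \<bullet> X (ts ! k) \<omega>))"

definition is_ofbm :: "'a measure \<Rightarrow> real^'n^'n \<Rightarrow> complex^'n^'n \<Rightarrow> (real \<Rightarrow> 'a \<Rightarrow> real^'n) \<Rightarrow> bool" where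
  "is_ofbm M D A B \<longleftrightarrow> centered_gaussian_process M B \<and>
     (\<forall>t s i j. complex_of_real (integral\<^sup>L M (\<lambda>\<omega>. B t \<omega> $ i * B s \<omega> $ j))
                 = ofbm_cov D A t s $ i $ j)"

definition is_single_param_ofbm :: "'a measure \<Rightarrow> (real \<Rightarrow> 'a \<Rightarrow> real^'n) \<Rightarrow> bool" where
  "is_single_param_ofbm M X \<longleftrightarrow> centered_gaussian_process M X \<and>
     (\<exists>h c. 0 < h \<and> h < 1 \<and> c > 0 \<and>
        (\<forall>t s i j. integral\<^sup>L M (\<lambda>\<omega>. X t \<omega> $ i * X s \<omega> $ j) =
           (if i = j then c / 2 * (\<bar>t\<bar> powr (2*h) + \<bar>s\<bar> powr (2*h) - \<bar>t - s\<bar> powr (2*h)) else 0)))"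

definition fdd_eq :: "'a measure \<Rightarrow> (real \<Rightarrow> 'a \<Rightarrow> real^'n) \<Rightarrow> 'b measure \<Rightarrow> (real \<Rightarrow> 'b \<Rightarrow> real^'n) \<Rightarrow> bool" where
  "fdd_eq M X N Y \<longleftrightarrow> (\<forall>ts :: real list.
     distr M (Pi\<^sub>M {..<length ts} (\<lambda>_. borel)) (\<lambda>\<omega>. \<lambda>k\<in>{..<length ts}. X (ts ! k) \<omega>) =
     distr N (Pi\<^sub>M {..<length ts} (\<lambda>_. borel)) (\<lambda>\<omega>. \<lambda>k\<in>{..<length ts}. Y (ts ! k) \<omega>))"

definition symmetry_group :: "'a measure \<Rightarrow> (real \<Rightarrow> 'a \<Rightarrow> real^'n) \<Rightarrow> (real^'n^'n) set" where
  "symmetry_group M X = {C. invertible C \<and> fdd_eq M (\<lambda>t \<omega>. C *v X t \<omega>) M X}"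

definition maximal_type :: "'a measure \<Rightarrow> (real \<Rightarrow> 'a \<Rightarrow> real^'n) \<Rightarrow> bool" where
  "maximal_type M X \<longleftrightarrow> (\<exists>W. pos_def W \<and>
     symmetry_group M X = {W ** U ** matrix_inv W | U. orthogonal_matrix U})"

end

theory Submission
  imports Defs "HOL-Computational_Algebra.Fundamental_Theorem_Algebra"
begin

text \<open>The symmetry group of a centered Gaussian process consists of the invertible \<open>C\<close> with
  \<open>C \<Gamma>(t,s) C\<^sup>* = \<Gamma>(t,s)\<close> for all covariances \<open>\<Gamma>(t,s)\<close>. If it contains \<open>W O(n) W\<inverse>\<close>, then every
  \<open>W\<inverse> \<Gamma>(t,s) W\<inverse>\<close> commutes with \<open>O(n)\<close> and is scalar, so \<open>\<Gamma>(t,s)\<close> is a multiple of \<open>W\<^sup>2\<close>. By injectivity of the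
  Fourier transform the spectral density \<open>x\<^sup>-\<^sup>D A A\<^sup>* x\<^sup>-\<^sup>D\<^sup>*\<close> is then a multiple of \<open>W\<^sup>2\<close> as well; its
  value and its derivative at \<open>x = 1\<close> give the two conditions. Conversely, the conditions make
  \<open>x\<^sup>-\<^sup>D \<Re>(A A\<^sup>*) x\<^sup>-\<^sup>D\<^sup>*\<close> solve a scalar linear ODE in \<open>log x\<close>, so the spectral density is
  \<open>|x|\<^sup>-\<^sup>2\<^sup>d \<Re>(A A\<^sup>*)\<close> and the covariance is that of a scalar fractional Brownian motion times \<open>\<Re>(A A\<^sup>*)\<close>.\<close>

section \<open>Uniqueness of characteristic functions and the Cramer-Wold theorem\<close>

text \<open>Covariances determine a Gaussian process only through a uniqueness theorem for vector
  laws; it is derived from the one-dimensional one. The hypothesis on the characteristic roots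
  enters as a strict growth bound: exp(sD) is O(exp(b|s|)) with b < 1/2. The strictness makes the
  covariance integrals converge, and it later forces |d| < 1/2, so that the Hurst parameter d + 1/2
  lies in (0,1). In the direction from maximal type, the scalar g(t,s) in Gamma(t,s) = g(t,s) W^2 is
  unknown. Cross-multiplying two entries eliminates it and leaves linear relations with constant
  coefficients, which pass to the spectral density. The Fourier exponentials come from increments:
  the transfer functions satisfy f_{t+1} - f_t = e^{itx} f_1. The relation between densities is at
  first known only almost everywhere on (0,2); continuity makes it pointwise, and since 1 is an
  interior point it may be differentiated there.\<close>

lemma emeasure_density_const_real:
  assumes "A \<in> sets M" "0 \<le> r"
  shows "emeasure (density M (\<lambda>_. ennreal r)) A = ennreal r * emeasure M A"
  using assms by (simp add: emeasure_density nn_integral_cmult_indicator)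

lemma char_density_const:
  assumes "sets M = sets borel" "0 \<le> r"
  shows "char (density M (\<lambda>_. ennreal r)) t = complex_of_real r * char M t"
proof -
  have "(\<lambda>x. iexp (t * x)) \<in> borel_measurable M"
    by (subst measurable_cong_sets[OF assms(1) refl]) measurable
  then show ?thesis
    using assms unfolding char_def
    by (subst integral_density) (auto simp: scaleR_conv_of_real)
qed

text \<open>The value at 0 is the total mass, so both masses agree. Dividing by a positive mass
  reduces to Levy's theorem for probability measures.\<close>

lemma finite_measure_char_unique:
  assumes "finite_measure M1" "finite_measure M2"
    and sets: "sets M1 = sets borel" "sets M2 = sets borel"
    and eq: "\<And>t. char M1 t = char M2 t"
  shows "M1 = M2"
proof -
  interpret M1: finite_measure M1 by fact
  interpret M2: finite_measure M2 by fact
  have sp: "space M1 = UNIV" "space M2 = UNIV"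
    using sets[THEN sets_eq_imp_space_eq] by simp_all
  define m where "m = measure M1 UNIV"
  have m2: "measure M2 UNIV = m"
    using eq[of 0] sp by (simp add: char_def m_def)
  show ?thesis
  proof (cases "m = 0")
    case True
    have "emeasure M1 A = 0" "emeasure M2 A = 0" for A
      using True m2 sp emeasure_space[of M1 A] emeasure_space[of M2 A]
      by (auto simp: m_def M1.emeasure_eq_measure M2.emeasure_eq_measure)
    then show ?thesis
      using sets by (intro measure_eqI) auto
  next
    case False
    then have m: "m > 0"
      by (simp add: m_def zero_less_measure_iff)
    define N where "N M = density M (\<lambda>_. ennreal (1 / m))" for M :: "real measure"
    have rd: "real_distribution (N M)"
      if "finite_measure M" "sets M = sets borel" "measure M UNIV = m" for M
    proof -
      interpret finite_measure M by fact
      have "space M = UNIV"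
        using that(2)[THEN sets_eq_imp_space_eq] by simp
      then have "prob_space (N M)"
        unfolding N_def using m that
        by (intro prob_spaceI)
          (simp add: emeasure_density_const_real emeasure_eq_measure flip: ennreal_mult)
      then show ?thesis
        using that(2) \<open>space M = UNIV\<close>
        by (simp add: real_distribution_def real_distribution_axioms_def N_def)
    qed
    have "char (N M1) = char (N M2)"
      using m eq sets by (intro ext) (simp add: N_def char_density_const del: ennreal_eq_1)
    then have "N M1 = N M2"
      using rd m2 sets assms(1,2) m_def by (intro Levy_uniqueness) auto
    then have *: "emeasure (N M1) A = emeasure (N M2) A" for A
      by simp
    show ?thesis
    proof (rule measure_eqI)
      fix A assume "A \<in> sets M1"
      then have "ennreal (1 / m) * emeasure M1 A = ennreal (1 / m) * emeasure M2 A"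
        using *[of A] m sets unfolding N_def by (simp add: emeasure_density_const_real)
      then show "emeasure M1 A = emeasure M2 A"
        using m by (simp add: ennreal_mult_cancel_left)
    qed (use sets in simp)
  qed
qed

lemma norm_iexp: "norm (iexp x) = 1"
  by (simp flip: exp_Reals_eq add: norm_exp_i_times)

text \<open>Adding the constant 2 to a function bounded by 1 turns the signed measure with that density
  into a positive one, to which the uniqueness theorem applies.\<close>

definition weighted_distr :: "'a measure \<Rightarrow> ('a \<Rightarrow> real) \<Rightarrow> ('a \<Rightarrow> real) \<Rightarrow> real measure" where
  "weighted_distr M X U = distr (density M (\<lambda>x. ennreal (2 + U x))) borel X"

lemma sets_weighted_distr [simp]: "sets (weighted_distr M X U) = sets borel"
  by (simp add: weighted_distr_def)

context prob_space
begin

context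
  fixes X U :: "'a \<Rightarrow> real"
  assumes [measurable]: "X \<in> borel_measurable M" "U \<in> borel_measurable M"
    and U_bound: "\<And>x. \<bar>U x\<bar> \<le> 1"
begin

private lemma two_plus_U_nonneg: "0 \<le> 2 + U x"
  using U_bound[of x] by linarith

lemma char_weighted_distr:
  "char (weighted_distr M X U) t
    = 2 * (CLINT x|M. iexp (t * X x)) + (CLINT x|M. of_real (U x) * iexp (t * X x))"
proof -
  have i1: "integrable M (\<lambda>x. iexp (t * X x))"
    by (rule integrable_const_bound[where B=1]) (auto simp: norm_iexp)
  have i2: "integrable M (\<lambda>x. of_real (U x) * iexp (t * X x))"
    by (rule integrable_const_bound[where B=1]) (use U_bound in \<open>auto simp: norm_iexp norm_mult\<close>)
  have "char (weighted_distr M X U) t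
      = (CLINT x|density M (\<lambda>x. ennreal (2 + U x)). iexp (t * X x))"
    unfolding char_def weighted_distr_def by (subst integral_distr) auto
  also have "\<dots> = (CLINT x|M. (2 + U x) *\<^sub>R iexp (t * X x))"
    by (subst integral_density) (use two_plus_U_nonneg in auto)
  also have "\<dots> = (CLINT x|M. 2 * iexp (t * X x) + of_real (U x) * iexp (t * X x))"
    by (intro Bochner_Integration.integral_cong) (auto simp: scaleR_conv_of_real algebra_simps)
  finally show ?thesis
    using i1 i2 by (simp add: Bochner_Integration.integral_add)
qed

lemma finite_measure_weighted_distr: "finite_measure (weighted_distr M X U)"
proof -
  have iU: "integrable M U"
    by (rule integrable_const_bound[where B=1]) (use U_bound in auto)
  have "emeasure (weighted_distr M X U) (space (weighted_distr M X U))
      = (\<integral>\<^sup>+x. ennreal (2 + U x) \<partial>M)"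
    unfolding weighted_distr_def
    by (subst emeasure_distr) (auto simp: emeasure_density cong: nn_integral_cong)
  also have "\<dots> = ennreal (LINT x|M. 2 + U x)"
    using iU two_plus_U_nonneg by (intro nn_integral_eq_integral) auto
  finally show ?thesis
    by (intro finite_measureI) auto
qed

lemma measure_weighted_distr:
  assumes [measurable]: "A \<in> sets borel"
  shows "measure (weighted_distr M X U) A
    = 2 * measure M {x \<in> space M. X x \<in> A} + (LINT x|M. U x * indicator A (X x))"
proof -
  have i3: "integrable M (\<lambda>x. U x * indicator A (X x))"
    by (rule integrable_const_bound[where B=1])
      (use U_bound in \<open>auto simp: abs_mult indicator_def\<close>)
  have i4: "integrable M (\<lambda>x. indicator A (X x) :: real)"
    by (rule integrable_const_bound[where B=1]) (auto simp: indicator_def)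
  have nn: "0 \<le> 2 * indicator A (X x) + U x * indicator A (X x)" for x
    using two_plus_U_nonneg[of x] by (auto simp: indicator_def)
  have "emeasure (weighted_distr M X U) A
      = (\<integral>\<^sup>+x. ennreal (2 * indicator A (X x) + U x * indicator A (X x)) \<partial>M)"
    unfolding weighted_distr_def
    by (subst emeasure_distr)
      (auto simp: emeasure_density intro!: nn_integral_cong split: split_indicator)
  also have "\<dots> = ennreal (LINT x|M. 2 * indicator A (X x) + U x * indicator A (X x))"
    using i3 i4 nn by (subst nn_integral_eq_integral) auto
  finally have "measure (weighted_distr M X U) A
      = (LINT x|M. 2 * indicator A (X x) + U x * indicator A (X x))"
    unfolding measure_def using nn by (simp add: Bochner_Integration.integral_nonneg)
  also have "\<dots> = 2 * (LINT x|M. indicator A (X x)) + (LINT x|M. U x * indicator A (X x))"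
    using i3 i4 by simp
  also have "(LINT x|M. indicator A (X x) :: real) = (LINT x|M. indicator {x \<in> space M. X x \<in> A} x)"
    by (intro Bochner_Integration.integral_cong) (auto simp: indicator_def)
  also have "\<dots> = measure M {x \<in> space M. X x \<in> A}"
    by simp
  finally show ?thesis .
qed

end

end

text \<open>The laws with weights 2 + U and 2 + V agree, and so do those with constant weight 2;
  subtracting leaves the integrals of U and V.\<close>

lemma integral_indicator_eq_real_weight:
  fixes X :: "'a \<Rightarrow> real" and Y :: "'b \<Rightarrow> real" and U :: "'a \<Rightarrow> real" and V :: "'b \<Rightarrow> real"
  assumes M: "prob_space M" and N: "prob_space N"
    and meas: "X \<in> borel_measurable M" "Y \<in> borel_measurable N"
      "U \<in> borel_measurable M" "V \<in> borel_measurable N"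
    and bd: "\<And>x. \<bar>U x\<bar> \<le> 1" "\<And>y. \<bar>V y\<bar> \<le> 1"
    and eq: "\<And>t. (CLINT x|M. iexp (t * X x)) = (CLINT y|N. iexp (t * Y y))"
    and eqw: "\<And>t. (CLINT x|M. of_real (U x) * iexp (t * X x))
      = (CLINT y|N. of_real (V y) * iexp (t * Y y))"
    and A: "A \<in> sets borel"
  shows "(LINT x|M. U x * indicator A (X x)) = (LINT y|N. V y * indicator A (Y y))"
proof -
  note c = prob_space.char_weighted_distr and f = prob_space.finite_measure_weighted_distr
    and m = prob_space.measure_weighted_distr
  have "weighted_distr M X U = weighted_distr N Y V"
    using f[OF M meas(1,3)] f[OF N meas(2,4)] c[OF M meas(1,3)] c[OF N meas(2,4)] bd eq eqw
    by (intro finite_measure_char_unique) auto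
  moreover have "weighted_distr M X (\<lambda>_. 0) = weighted_distr N Y (\<lambda>_. 0)"
    using f[OF M meas(1), of "\<lambda>_. 0"] f[OF N meas(2), of "\<lambda>_. 0"]
      c[OF M meas(1), of "\<lambda>_. 0"] c[OF N meas(2), of "\<lambda>_. 0"] eq
    by (intro finite_measure_char_unique) auto
  ultimately show ?thesis
    using m[OF M meas(1,3) bd(1) A] m[OF N meas(2,4) bd(2) A]
      m[OF M meas(1) _ _ A, of "\<lambda>_. 0"] m[OF N meas(2) _ _ A, of "\<lambda>_. 0"] by simp
qed

lemma iexp_minus: "iexp (- x) = cnj (iexp x)"
  by (simp add: exp_cnj)

text \<open>Conjugating the transform of \<open>Z\<close> at -t gives that of \<open>cnj Z\<close>
  at t. Hence equality of the transforms of two complex weights is inherited by their real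
  parts.\<close>

lemma (in prob_space) integral_Re_iexp:
  assumes [measurable]: "X \<in> borel_measurable M" "Z \<in> borel_measurable M"
    and Z: "\<And>x. cmod (Z x) \<le> 1"
  shows "(CLINT x|M. of_real (Re (Z x)) * iexp (t * X x))
    = ((CLINT x|M. Z x * iexp (t * X x)) + cnj (CLINT x|M. Z x * iexp ((- t) * X x))) / 2"
proof -
  have int: "integrable M (\<lambda>x. Z x * iexp (s * X x))" for s
    by (rule integrable_const_bound[where B=1]) (use Z in \<open>auto simp: norm_iexp norm_mult\<close>)
  have "of_real (Re (Z x)) * iexp (t * X x)
      = (Z x * iexp (t * X x) + cnj (Z x * iexp ((- t) * X x))) / 2" for x
  proof -
    have "cnj (iexp ((- t) * X x)) = iexp (t * X x)"
      using iexp_minus[of "t * X x"] by simp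
    then show ?thesis
      by (simp add: complex_eq_iff field_simps del: of_real_mult)
  qed
  then have "(CLINT x|M. of_real (Re (Z x)) * iexp (t * X x))
      = (CLINT x|M. (Z x * iexp (t * X x) + cnj (Z x * iexp ((- t) * X x))) / 2)"
    by (simp only:)
  also have "\<dots> = ((CLINT x|M. Z x * iexp (t * X x)) + (CLINT x|M. cnj (Z x * iexp ((- t) * X x)))) / 2"
    using int[of t] int[of "- t"]
    by (subst Bochner_Integration.integral_add[symmetric])
      (simp_all only: integrable_cnj integral_divide_zero)
  finally show ?thesis
    by (simp only: Bochner_Integration.integral_cnj)
qed

lemma integral_indicator_eq_weight:
  fixes X :: "'a \<Rightarrow> real" and Y :: "'b \<Rightarrow> real" and Z :: "'a \<Rightarrow> complex" and Z' :: "'b \<Rightarrow> complex"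
  assumes "prob_space M" "prob_space N"
    and [measurable]: "X \<in> borel_measurable M" "Y \<in> borel_measurable N"
      "Z \<in> borel_measurable M" "Z' \<in> borel_measurable N"
    and bd: "\<And>x. cmod (Z x) \<le> 1" "\<And>y. cmod (Z' y) \<le> 1"
    and eq: "\<And>t. (CLINT x|M. iexp (t * X x)) = (CLINT y|N. iexp (t * Y y))"
    and eqw: "\<And>t. (CLINT x|M. Z x * iexp (t * X x)) = (CLINT y|N. Z' y * iexp (t * Y y))"
    and A[measurable]: "A \<in> sets borel"
  shows "(CLINT x|M. Z x * indicator A (X x)) = (CLINT y|N. Z' y * indicator A (Y y))"
proof -
  interpret M: prob_space M by fact
  interpret N: prob_space N by fact
  have re: "(LINT x|M. Re (Z x) * indicator A (X x)) = (LINT y|N. Re (Z' y) * indicator A (Y y))"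
  proof (rule integral_indicator_eq_real_weight[OF assms(1,2)])
    show "(CLINT x|M. of_real (Re (Z x)) * iexp (t * X x))
        = (CLINT y|N. of_real (Re (Z' y)) * iexp (t * Y y))" for t
      unfolding M.integral_Re_iexp[OF assms(3,5) bd(1)] N.integral_Re_iexp[OF assms(4,6) bd(2)] eqw ..
    show "\<bar>Re (Z x)\<bar> \<le> 1" "\<bar>Re (Z' y)\<bar> \<le> 1" for x y
      using bd abs_Re_le_cmod order_trans by blast+
  qed (use eq in auto)
  \<comment> \<open>The real part of -i Z is the imaginary part of Z, so the real case serves a
    second time.\<close>
  have im: "(LINT x|M. Re (- \<i> * Z x) * indicator A (X x)) = (LINT y|N. Re (- \<i> * Z' y) * indicator A (Y y))"
  proof (rule integral_indicator_eq_real_weight[OF assms(1,2)])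
    have b: "cmod (- \<i> * Z x) \<le> 1" "cmod (- \<i> * Z' y) \<le> 1" for x y
      using bd by (auto simp: norm_mult)
    have m: "(\<lambda>x. - \<i> * Z x) \<in> borel_measurable M" "(\<lambda>y. - \<i> * Z' y) \<in> borel_measurable N"
      by measurable
    have "(CLINT x|M. - \<i> * Z x * iexp (t * X x)) = (CLINT y|N. - \<i> * Z' y * iexp (t * Y y))" for t
      using eqw[of t] unfolding mult.assoc by simp
    then show "(CLINT x|M. of_real (Re (- \<i> * Z x)) * iexp (t * X x))
        = (CLINT y|N. of_real (Re (- \<i> * Z' y)) * iexp (t * Y y))" for t
      using M.integral_Re_iexp[OF assms(3) m(1) b(1), of t] N.integral_Re_iexp[OF assms(4) m(2) b(2), of t]
      by (simp only:)
    show "\<bar>Re (- \<i> * Z x)\<bar> \<le> 1" "\<bar>Re (- \<i> * Z' y)\<bar> \<le> 1" for x y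
      using b abs_Re_le_cmod order_trans by blast+
  qed (use eq in auto)
  have int: "integrable M (\<lambda>x. Z x * indicator A (X x))"
    by (rule M.integrable_const_bound[where B=1])
      (use bd in \<open>auto simp: norm_mult indicator_def\<close>)
  have int': "integrable N (\<lambda>x. Z' x * indicator A (Y x))"
    by (rule N.integrable_const_bound[where B=1])
      (use bd in \<open>auto simp: norm_mult indicator_def\<close>)
  have *: "Re (z * indicator A x) = Re z * indicator A x" "Im (z * indicator A x) = Im z * indicator A x" for z x
    by (auto simp: indicator_def)
  show ?thesis
    using re im integral_Re[OF int] integral_Im[OF int] integral_Re[OF int'] integral_Im[OF int']
    by (simp only: * complex_eq_iff) simp
qed

lemma iexp_add: "iexp (a + b) = iexp a * iexp b"
  by (simp add: exp_add distrib_left)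

text \<open>The exponential factors are exchanged for indicators one index at a time.\<close>

lemma integral_prod_indicator_iexp_eq:
  fixes X :: "'j \<Rightarrow> 'a \<Rightarrow> real" and Y :: "'j \<Rightarrow> 'b \<Rightarrow> real"
  assumes M: "prob_space M" and N: "prob_space N"
    and X: "\<And>j. X j \<in> borel_measurable M" and Y: "\<And>j. Y j \<in> borel_measurable N"
    and J: "finite J"
    and eq: "\<And>t. (CLINT x|M. iexp (\<Sum>j\<in>J. t j * X j x)) = (CLINT y|N. iexp (\<Sum>j\<in>J. t j * Y j y))"
    and A: "\<And>j. A j \<in> sets borel"
    and "K \<subseteq> J"
  shows "(CLINT x|M. (\<Prod>j\<in>K. indicator (A j) (X j x)) * iexp (\<Sum>j\<in>J - K. t j * X j x))
    = (CLINT y|N. (\<Prod>j\<in>K. indicator (A j) (Y j y)) * iexp (\<Sum>j\<in>J - K. t j * Y j y))"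
  using finite_subset[OF \<open>K \<subseteq> J\<close> J] \<open>K \<subseteq> J\<close>
proof (induction K arbitrary: t rule: finite_subset_induct')
  case empty
  then show ?case
    using eq[of t] by simp
next
  case (insert k F)
  note [measurable] = X Y A
  have "finite F" "k \<in> J" "k \<notin> F" "finite (J - F)"
    using insert J by (auto intro: finite_subset)
  \<comment> \<open>The complex weight collects everything except index \<open>k\<close>: the
    indicators already in place and the exponentials still to be exchanged. Its modulus is at most
    1.\<close>
  define Zx where "Zx x = (\<Prod>j\<in>F. indicator (A j) (X j x)) * iexp (\<Sum>j\<in>J - insert k F. t j * X j x)" for x
  define Zy where "Zy y = (\<Prod>j\<in>F. indicator (A j) (Y j y)) * iexp (\<Sum>j\<in>J - insert k F. t j * Y j y)" for y
  have split: "(\<Sum>j\<in>J - F. (t(k := s)) j * f j) = (\<Sum>j\<in>J - insert k F. t j * f j) + s * f k"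
    for s and f :: "'j \<Rightarrow> real"
  proof -
    have "J - F = insert k (J - insert k F)"
      using \<open>k \<in> J\<close> \<open>k \<notin> F\<close> by auto
    then have "(\<Sum>j\<in>J - F. (t(k := s)) j * f j)
        = (\<Sum>j\<in>insert k (J - insert k F). (t(k := s)) j * f j)"
      by (rule arg_cong)
    then show ?thesis
      using J by simp
  qed
  have prod_le: "cmod (\<Prod>j\<in>F. indicator (A j) (f j)) \<le> 1" for f
    by (subst prod_norm[symmetric], rule prod_le_1) (simp add: indicator_def)
  have "(CLINT x|M. Zx x * indicator (A k) (X k x)) = (CLINT y|N. Zy y * indicator (A k) (Y k y))"
  proof (rule integral_indicator_eq_weight[OF M N X Y])
    show "Zx \<in> borel_measurable M" "Zy \<in> borel_measurable N"
      unfolding Zx_def Zy_def by measurable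
    show "cmod (Zx x) \<le> 1" "cmod (Zy y) \<le> 1" for x y
      unfolding Zx_def Zy_def norm_mult norm_iexp using prod_le by simp_all
    \<comment> \<open>Frequencies that vanish off \<open>k\<close> give the marginal transform; in
      the weighted case below, the induction hypothesis is used with the frequency at
      \<open>k\<close> left free.\<close>
    show "(CLINT x|M. iexp (s * X k x)) = (CLINT y|N. iexp (s * Y k y))" for s
      using eq[of "(\<lambda>_. 0)(k := s)"] J \<open>k \<in> J\<close> by (simp add: if_distrib[of "\<lambda>c. c * _"] cong: if_cong)
    show "(CLINT x|M. Zx x * iexp (s * X k x)) = (CLINT y|N. Zy y * iexp (s * Y k y))" for s
      using insert.IH[of "t(k := s)"] unfolding split iexp_add Zx_def Zy_def by (simp only: mult.assoc)
  qed (use A in auto)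
  then show ?case
    using \<open>finite F\<close> \<open>k \<notin> F\<close> unfolding Zx_def Zy_def by (simp add: ac_simps)
qed

lemma emeasure_distr_restrict_PiE:
  assumes M: "prob_space M" and J: "finite J" and [measurable]: "\<And>j. X j \<in> borel_measurable M"
    and [measurable]: "\<And>j. A j \<in> sets (borel :: real measure)"
  shows "emeasure (distr M (PiM J (\<lambda>_. borel)) (\<lambda>x. \<lambda>j\<in>J. X j x)) (Pi\<^sub>E J A)
    = ennreal (Re (CLINT x|M. (\<Prod>j\<in>J. indicator (A j) (X j x))))"
proof -
  interpret prob_space M by fact
  have *: "complex_of_real (indicator {x \<in> space M. \<forall>j\<in>J. X j x \<in> A j} x)
      = (\<Prod>j\<in>J. indicator (A j) (X j x))" if "x \<in> space M" for x
    using that J by (auto simp: indicator_def prod_zero_iff)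
  have "{x \<in> space M. \<forall>j\<in>J. X j x \<in> A j} \<in> sets M"
    using J by measurable
  then have "of_real (measure M {x \<in> space M. \<forall>j\<in>J. X j x \<in> A j})
      = (CLINT x|M. of_real (indicator {x \<in> space M. \<forall>j\<in>J. X j x \<in> A j} x))"
    by (simp add: integral_complex_of_real)
  also have "\<dots> = (CLINT x|M. (\<Prod>j\<in>J. indicator (A j) (X j x)))"
    by (intro Bochner_Integration.integral_cong refl *)
  finally have "of_real (measure M {x \<in> space M. \<forall>j\<in>J. X j x \<in> A j})
      = (CLINT x|M. (\<Prod>j\<in>J. indicator (A j) (X j x)))" .
  from arg_cong[where f = Re, OF this]
  have "measure M {x \<in> space M. \<forall>j\<in>J. X j x \<in> A j}
      = Re (CLINT x|M. (\<Prod>j\<in>J. indicator (A j) (X j x)))"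
    by (simp only: Re_complex_of_real)
  moreover have "emeasure (distr M (PiM J (\<lambda>_. borel)) (\<lambda>x. \<lambda>j\<in>J. X j x)) (Pi\<^sub>E J A)
      = emeasure M ((\<lambda>x. \<lambda>j\<in>J. X j x) -` (Pi\<^sub>E J A) \<inter> space M)"
  proof (rule emeasure_distr)
    show "Pi\<^sub>E J A \<in> sets (PiM J (\<lambda>_. borel))"
      using J by (intro sets_PiM_I_finite) simp_all
  qed measurable
  moreover have "(\<lambda>x. \<lambda>j\<in>J. X j x) -` (Pi\<^sub>E J A) \<inter> space M = {x \<in> space M. \<forall>j\<in>J. X j x \<in> A j}"
    by auto
  ultimately show ?thesis
    by (simp add: emeasure_eq_measure)
qed

text \<open>With all exponentials exchanged, the two laws agree on boxes, and boxes form an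
  intersection-stable generator of the product sigma-algebra.\<close>

theorem cramer_wold:
  fixes X :: "'j \<Rightarrow> 'a \<Rightarrow> real" and Y :: "'j \<Rightarrow> 'b \<Rightarrow> real"
  assumes M: "prob_space M" and N: "prob_space N"
    and X: "\<And>j. X j \<in> borel_measurable M" and Y: "\<And>j. Y j \<in> borel_measurable N"
    and J: "finite J"
    and eq: "\<And>t. (CLINT x|M. iexp (\<Sum>j\<in>J. t j * X j x)) = (CLINT y|N. iexp (\<Sum>j\<in>J. t j * Y j y))"
  shows "distr M (PiM J (\<lambda>_. borel)) (\<lambda>x. \<lambda>j\<in>J. X j x) = distr N (PiM J (\<lambda>_. borel)) (\<lambda>y. \<lambda>j\<in>J. Y j y)"
    (is "?P = ?Q")
proof (rule measure_eqI_PiM_finite[OF J])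
  note [measurable] = X Y
  interpret P: prob_space ?P
    by (intro prob_space.prob_space_distr M) measurable
  show "emeasure ?P (Pi\<^sub>E J A) = emeasure ?Q (Pi\<^sub>E J A)" if A: "\<And>j. j \<in> J \<Longrightarrow> A j \<in> sets borel" for A
  proof -
    \<comment> \<open>The exchange lemma asks for a Borel set at every index; indices outside
      \<open>J\<close> get the empty set, which does not affect the box over
      \<open>J\<close>.\<close>
    define A' where "A' j = (if j \<in> J then A j else {})" for j
    have A': "A' j \<in> sets borel" for j
      using A by (simp add: A'_def)
    have "Pi\<^sub>E J A = Pi\<^sub>E J A'"
      by (intro PiE_cong) (simp add: A'_def)
    then show ?thesis
      using integral_prod_indicator_iexp_eq[OF M N X Y J eq A', where K = J and t = "\<lambda>_. 0"]
      by (simp add: emeasure_distr_restrict_PiE[OF M J X A'] emeasure_distr_restrict_PiE[OF N J Y A'])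
  qed
  have "(\<Pi>\<^sub>E j\<in>J. UNIV :: real set) \<in> prod_algebra J (\<lambda>_. borel)"
    using J by (intro prod_algebraI_finite) auto
  then show "range (\<lambda>_::nat. \<Pi>\<^sub>E j\<in>J. UNIV :: real set) \<subseteq> prod_algebra J (\<lambda>_. borel)"
    by auto
  show "(\<Union>i::nat. \<Pi>\<^sub>E j\<in>J. UNIV :: real set) = space (PiM J (\<lambda>_. borel))"
    by (simp add: space_PiM)
  show "emeasure ?P (\<Pi>\<^sub>E j\<in>J. UNIV) \<noteq> \<infinity>"
    by simp
qed auto

section \<open>Injectivity of the Fourier transform on integrable functions\<close>

text \<open>The positive and negative parts of \<open>w\<close> are densities of finite measures
  with equal characteristic functions. So the two parts coincide almost everywhere, which is
  possible only where \<open>w\<close> is 0.\<close>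

lemma fourier_injective_real:
  fixes w :: "real \<Rightarrow> real"
  assumes w: "integrable lborel w"
    and eq: "\<And>t. (CLBINT x. of_real (w x) * iexp (t * x)) = 0"
  shows "AE x in lborel. w x = 0"
proof -
  have [measurable]: "w \<in> borel_measurable borel"
    using w by auto
  define P where "P f = density lborel (\<lambda>x. ennreal (max 0 (f x)))" for f :: "real \<Rightarrow> real"
  have int: "integrable lborel (\<lambda>x. max 0 (w x))" "integrable lborel (\<lambda>x. max 0 (- w x))"
    using w by auto
  have char: "char (P f) t = (CLBINT x. of_real (max 0 (f x)) * iexp (t * x))"
    if "f \<in> borel_measurable borel" for f t
    using that unfolding char_def P_def
    by (subst integral_density) (auto simp: scaleR_conv_of_real)
  have fin: "finite_measure (P f)"
    if "integrable lborel (\<lambda>x. max 0 (f x))" and [measurable]: "f \<in> borel_measurable borel" for f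
  proof
    have "emeasure (P f) (space (P f)) = (\<integral>\<^sup>+x. ennreal (max 0 (f x)) \<partial>lborel)"
      unfolding P_def by (subst emeasure_density) (simp_all add: indicator_def)
    also have "\<dots> = ennreal (LBINT x. max 0 (f x))"
      using that by (intro nn_integral_eq_integral) auto
    finally show "emeasure (P f) (space (P f)) \<noteq> \<infinity>" by simp
  qed
  have "P w = P (\<lambda>x. - w x)"
  proof (rule finite_measure_char_unique)
    fix t
    have i: "integrable lborel (\<lambda>x. of_real (max 0 (f x)) * iexp (t * x))"
      if "integrable lborel (\<lambda>x. max 0 (f x))" for f :: "real \<Rightarrow> real"
      using that
      by (rule Bochner_Integration.integrable_bound) (use that in \<open>auto simp: norm_mult norm_iexp\<close>)
    have "char (P w) t - char (P (\<lambda>x. - w x)) t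
        = (CLBINT x. of_real (max 0 (w x)) * iexp (t * x) - of_real (max 0 (- w x)) * iexp (t * x))"
      using i[OF int(1)] i[OF int(2)] by (simp add: char Bochner_Integration.integral_diff)
    also have "\<dots> = (CLBINT x. of_real (w x) * iexp (t * x))"
      by (intro Bochner_Integration.integral_cong) (auto simp: max_def)
    finally show "char (P w) t = char (P (\<lambda>x. - w x)) t"
      using eq by simp
  qed (use fin int in \<open>auto simp: P_def\<close>)
  then have "AE x in lborel. ennreal (max 0 (w x)) = ennreal (max 0 (- w x))"
    unfolding P_def by (intro sigma_finite_measure.density_unique lborel.sigma_finite_measure_axioms) auto
  then show ?thesis
    by eventually_elim (auto simp: max_def split: if_splits)
qed


text \<open>The transform of \<open>cnj w\<close> at t is the conjugate of that of \<open>w\<close>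
  at -t and vanishes too; averaging the two gives the transform of the real part.\<close>

lemma fourier_injective_Re:
  fixes w :: "real \<Rightarrow> complex"
  assumes w: "integrable lborel w"
    and eq: "\<And>t. (CLBINT x. w x * iexp (t * x)) = 0"
  shows "AE x in lborel. Re (w x) = 0"
proof (rule fourier_injective_real)
  fix t
  have [measurable]: "w \<in> borel_measurable borel"
    using w by auto
  have int: "integrable lborel (\<lambda>x. w x * iexp (t * x))" for t
    using w by (rule Bochner_Integration.integrable_bound) (auto simp: norm_mult norm_iexp)
  have cnj: "cnj (iexp ((- t) * x)) = iexp (t * x)" for t x
    using iexp_minus[of "t * x"] by simp
  have int': "integrable lborel (\<lambda>x. cnj (w x) * iexp (t * x))"
    using integrable_cnj[OF int[of "- t"]] unfolding complex_cnj_mult cnj .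
  have "(CLBINT x. cnj (w x) * iexp (t * x)) = (CLBINT x. cnj (w x * iexp ((- t) * x)))"
    unfolding complex_cnj_mult cnj ..
  then have cnj0: "(CLBINT x. cnj (w x) * iexp (t * x)) = 0"
    using eq[of "- t"] by (simp only: Bochner_Integration.integral_cnj complex_cnj_zero)
  have "of_real (Re (w x)) * iexp (t * x) = (w x * iexp (t * x) + cnj (w x) * iexp (t * x)) / 2" for x
    by (simp add: complex_eq_iff field_simps del: of_real_mult)
  then show "(CLBINT x. of_real (Re (w x)) * iexp (t * x)) = 0"
    using int[of t] int' eq[of t] cnj0
    by (simp only: integral_divide_zero Bochner_Integration.integral_add) simp
qed (use w in simp)

lemma fourier_injective:
  fixes w :: "real \<Rightarrow> complex"
  assumes w: "integrable lborel w"
    and eq: "\<And>t. (CLBINT x. w x * iexp (t * x)) = 0"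
  shows "AE x in lborel. w x = 0"
proof -
  have "(CLBINT x. (- \<i> * w x) * iexp (t * x)) = 0" for t
    using eq[of t] unfolding mult.assoc by simp
  then have "AE x in lborel. Re (- \<i> * w x) = 0"
    using w by (intro fourier_injective_Re) simp_all
  with fourier_injective_Re[OF w eq] show ?thesis
    by eventually_elim (simp add: complex_eq_iff)
qed

section \<open>Centered Gaussian processes\<close>

lemma borel_measurable_vec_iff:
  "f \<in> borel_measurable M \<longleftrightarrow> (\<forall>i. (\<lambda>x. f x $ i) \<in> borel_measurable M)"
  for f :: "'a \<Rightarrow> real^'n"
proof -
  have "(\<forall>b\<in>Basis. (\<lambda>x. f x \<bullet> b) \<in> borel_measurable M) \<longleftrightarrow> (\<forall>i. (\<lambda>x. f x $ i) \<in> borel_measurable M)"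
    by (auto simp: Basis_vec_def inner_axis)
  then show ?thesis
    by (simp add: borel_measurable_euclidean_space[of f])
qed

lemma measurable_vec_nth [measurable (raw)]:
  "f \<in> borel_measurable M \<Longrightarrow> (\<lambda>x. f x $ i) \<in> borel_measurable M" for f :: "'a \<Rightarrow> real^'n"
  using borel_measurable_vec_iff by blast

lemma measurable_matrix_vector_mult [measurable (raw)]:
  "f \<in> borel_measurable M \<Longrightarrow> (\<lambda>x. C *v f x) \<in> borel_measurable M"
  for f :: "'a \<Rightarrow> real^'n" and C :: "real^'n^'m"
  unfolding matrix_vector_mult_def borel_measurable_vec_iff
  by (auto intro!: borel_measurable_sum borel_measurable_times)

text \<open>The degenerate law is included as variance 0, so a single formula gives the
  characteristic function from the second moment. The other case is a rescaled standard
  normal.\<close>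

lemma (in prob_space) centered_gaussian_rv_moments:
  assumes "centered_gaussian_rv M Y"
  shows "integrable M (\<lambda>x. (Y x)\<^sup>2)"
    and "(CLINT x|M. iexp (Y x)) = complex_of_real (exp (- (LINT x|M. (Y x)\<^sup>2) / 2))"
proof -
  have [measurable]: "Y \<in> borel_measurable M"
    using assms by (simp add: centered_gaussian_rv_def)
  have "integrable M (\<lambda>x. (Y x)\<^sup>2) \<and>
    (CLINT x|M. iexp (Y x)) = complex_of_real (exp (- (LINT x|M. (Y x)\<^sup>2) / 2))"
    using assms unfolding centered_gaussian_rv_def
  proof (elim conjE disjE exE)
    assume ae: "AE x in M. Y x = 0"
    have "integrable M (\<lambda>x. (Y x)\<^sup>2) \<longleftrightarrow> integrable M (\<lambda>x. 0 :: real)"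
      by (rule integrable_cong_AE) (use ae in auto)
    moreover have "(LINT x|M. (Y x)\<^sup>2) = (LINT x|M. 0)"
      by (rule integral_cong_AE) (use ae in auto)
    moreover have "(CLINT x|M. iexp (Y x)) = (CLINT x|M. 1)"
      by (rule integral_cong_AE) (use ae in auto)
    ultimately show ?thesis
      by (simp add: prob_space)
  next
    fix \<sigma> :: real assume \<sigma>: "\<sigma> > 0" and d: "distributed M lborel Y (normal_density 0 \<sigma>)"
    define S where "S x = Y x / \<sigma>" for x
    have std: "distributed M lborel S std_normal_density"
      using normal_standard_normal_convert[OF \<sigma>, of Y 0] d by (simp add: S_def[abs_def])
    have Y: "Y x = \<sigma> * S x" for x
      using \<sigma> by (simp add: S_def)
    have [measurable]: "S \<in> borel_measurable M"
      unfolding S_def by measurable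
    have distr_S: "distr M borel S = std_normal_distribution"
      using distributed_distr_eq_density[OF std] by (metis distr_cong sets_lborel)
    have i2: "integrable std_normal_distribution (\<lambda>x. x^2)"
      by (rule integrable_std_normal_distribution_moment)
    have "(LINT x|std_normal_distribution. x ^ 2) = 1"
      using std_normal_distribution_even_moments[of 1] by (simp add: has_bochner_integral_iff)
    then have "(LINT x|M. (S x)\<^sup>2) = 1"
      unfolding distr_S[symmetric] by (subst (asm) integral_distr) auto
    moreover have "integrable M (\<lambda>x. (S x)\<^sup>2)"
      using i2 unfolding distr_S[symmetric] by (subst (asm) integrable_distr_eq) auto
    moreover have "char (distr M borel S) \<sigma> = (CLINT x|M. iexp (\<sigma> * S x))"
      unfolding char_def by (subst integral_distr) auto
    ultimately show ?thesis
      unfolding Y power_mult_distrib by (simp add: distr_S char_std_normal_distribution)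
  qed
  then show "integrable M (\<lambda>x. (Y x)\<^sup>2)"
    and "(CLINT x|M. iexp (Y x)) = complex_of_real (exp (- (LINT x|M. (Y x)\<^sup>2) / 2))"
    by auto
qed

context
  fixes M :: "'a measure" and X :: "real \<Rightarrow> 'a \<Rightarrow> real^'n"
  assumes M: "prob_space M" and X: "centered_gaussian_process M X"
begin

lemma gaussian_process_measurable: "X t \<in> borel_measurable M"
  using X by (simp add: centered_gaussian_process_def)

lemma gaussian_process_linear:
  "length cs = length ts \<Longrightarrow> centered_gaussian_rv M (\<lambda>\<omega>. \<Sum>k<length ts. (cs ! k) \<bullet> X (ts ! k) \<omega>)"
  using X by (simp add: centered_gaussian_process_def)

lemma gaussian_process_prod_integrable: "integrable M (\<lambda>\<omega>. X t \<omega> $ i * X s \<omega> $ j)"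
proof -
  note [measurable] = gaussian_process_measurable
  \<comment> \<open>One time and one coordinate vector make each component a Gaussian scalar;
    products are then dominated by sums of squares.\<close>
  have sq: "integrable M (\<lambda>\<omega>. (X t \<omega> $ i)\<^sup>2)" for t i
    using prob_space.centered_gaussian_rv_moments(1)[OF M gaussian_process_linear[of "[axis i 1]" "[t]"]]
    by (simp add: inner_axis')
  show ?thesis
    by (rule Bochner_Integration.integrable_bound[OF Bochner_Integration.integrable_add[OF sq[of t i] sq[of s j]]])
      (auto simp: abs_mult intro!: AE_I2 order_trans[OF _ abs_ge_self]
        intro: order_trans[OF _ sum_squares_bound[of "\<bar>_\<bar>" "\<bar>_\<bar>", simplified]])
qed

lemma gaussian_process_linear_variance:
  assumes "length cs = length ts"
  shows "(LINT \<omega>|M. (\<Sum>k<length ts. (cs ! k) \<bullet> X (ts ! k) \<omega>)\<^sup>2)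
    = (\<Sum>k<length ts. \<Sum>i\<in>UNIV. \<Sum>l<length ts. \<Sum>j\<in>UNIV.
        cs ! k $ i * cs ! l $ j * (LINT \<omega>|M. X (ts ! k) \<omega> $ i * X (ts ! l) \<omega> $ j))"
proof -
  have "(\<Sum>k<length ts. (cs ! k) \<bullet> X (ts ! k) \<omega>)\<^sup>2
    = (\<Sum>k<length ts. \<Sum>i\<in>UNIV. \<Sum>l<length ts. \<Sum>j\<in>UNIV.
        cs ! k $ i * cs ! l $ j * (X (ts ! k) \<omega> $ i * X (ts ! l) \<omega> $ j))" for \<omega>
    unfolding power2_eq_square inner_vec_def sum_distrib_left sum_distrib_right
    by (intro sum.cong refl) (simp add: ac_simps)
  then show ?thesis
    using gaussian_process_prod_integrable by simp
qed

text \<open>Pairing C X with a vector c is pairing X with the transpose of C applied to c.\<close>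

lemma gaussian_process_linear_image: "centered_gaussian_process M (\<lambda>t \<omega>. C *v X t \<omega>)" for C :: "real^'n^'m"
  unfolding centered_gaussian_process_def
proof (intro conjI allI impI)
  note [measurable] = gaussian_process_measurable
  show "(\<lambda>\<omega>. C *v X t \<omega>) \<in> borel_measurable M" for t
    by measurable
  fix ts :: "real list" and cs :: "(real^'m) list" assume len: "length cs = length ts"
  have "(\<Sum>k<length ts. cs ! k \<bullet> (C *v X (ts ! k) \<omega>))
      = (\<Sum>k<length ts. map (\<lambda>c. transpose C *v c) cs ! k \<bullet> X (ts ! k) \<omega>)" for \<omega>
    using len by (intro sum.cong refl) (simp add: dot_lmul_matrix)
  then show "centered_gaussian_rv M (\<lambda>\<omega>. \<Sum>k<length ts. cs ! k \<bullet> (C *v X (ts ! k) \<omega>))"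
    using gaussian_process_linear[of "map (\<lambda>c. transpose C *v c) cs" ts] len by simp
qed

end

lemma integral_pair_marginal:
  fixes X :: "real \<Rightarrow> 'a \<Rightarrow> real^'n"
  assumes [measurable]: "\<And>t. X t \<in> borel_measurable M"
  shows "(LINT f|distr M (Pi\<^sub>M {..<2} (\<lambda>_. borel)) (\<lambda>\<omega>. \<lambda>k\<in>{..<2}. X ([t, s] ! k) \<omega>). f 0 $ i * f 1 $ j)
    = (LINT \<omega>|M. X t \<omega> $ i * X s \<omega> $ j)"
proof -
  have "(\<lambda>f. f 0 $ i * f 1 $ j) \<in> borel_measurable (Pi\<^sub>M {..<2::nat} (\<lambda>_. borel :: (real^'n) measure))"
    by measurable
  then show ?thesis
    by (subst integral_distr) auto
qed

lemma fdd_eq_imp_cov_eq: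
  fixes X :: "real \<Rightarrow> 'a \<Rightarrow> real^'n" and Y :: "real \<Rightarrow> 'b \<Rightarrow> real^'n"
  assumes meas: "\<And>t. X t \<in> borel_measurable M" "\<And>t. Y t \<in> borel_measurable N"
    and eq: "fdd_eq M X N Y"
  shows "(LINT \<omega>|M. X t \<omega> $ i * X s \<omega> $ j) = (LINT \<omega>|N. Y t \<omega> $ i * Y s \<omega> $ j)"
proof -
  have "distr M (Pi\<^sub>M {..<2} (\<lambda>_. borel)) (\<lambda>\<omega>. \<lambda>k\<in>{..<2}. X ([t, s] ! k) \<omega>)
      = distr N (Pi\<^sub>M {..<2} (\<lambda>_. borel)) (\<lambda>\<omega>. \<lambda>k\<in>{..<2}. Y ([t, s] ! k) \<omega>)"
    using eq[unfolded fdd_eq_def, rule_format, of "[t, s]"] by (simp add: numeral_2_eq_2)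
  then show ?thesis
    unfolding integral_pair_marginal[of X M t s i j, OF meas(1), symmetric]
      integral_pair_marginal[of Y N t s i j, OF meas(2), symmetric] by simp
qed

text \<open>Corresponding linear combinations are centered Gaussian with variances built from the
  same covariances, so their characteristic functions agree and \<open>cramer_wold\<close>
  applies.\<close>

lemma gaussian_fdd_eqI:
  fixes X :: "real \<Rightarrow> 'a \<Rightarrow> real^'n" and Y :: "real \<Rightarrow> 'b \<Rightarrow> real^'n"
  assumes M: "prob_space M" and N: "prob_space N"
    and X: "centered_gaussian_process M X" and Y: "centered_gaussian_process N Y"
    and cov: "\<And>t s i j. (LINT \<omega>|M. X t \<omega> $ i * X s \<omega> $ j) = (LINT \<omega>|N. Y t \<omega> $ i * Y s \<omega> $ j)"
  shows "fdd_eq M X N Y"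
  unfolding fdd_eq_def
proof
  fix ts :: "real list"
  define m where "m = length ts"
  \<comment> \<open>Pairs of a time index and a coordinate index scalar variables, to which
    \<open>cramer_wold\<close> applies; \<open>h\<close> bundles them back into vectors, and pushing
    the scalar laws forward along \<open>h\<close> gives the claim.\<close>
  define J where "J = {..<m} \<times> (UNIV :: 'n set)"
  define h where "h f = (\<lambda>k\<in>{..<m}. \<chi> i. f (k, i))" for f :: "nat \<times> 'n \<Rightarrow> real"
  define XJ where "XJ j \<omega> = X (ts ! fst j) \<omega> $ snd j" for j \<omega>
  define YJ where "YJ j \<omega> = Y (ts ! fst j) \<omega> $ snd j" for j \<omega>
  note [measurable] = gaussian_process_measurable[OF M X] gaussian_process_measurable[OF N Y]
  have mJ: "XJ j \<in> borel_measurable M" "YJ j \<in> borel_measurable N" for j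
    unfolding XJ_def YJ_def by measurable
  have J: "finite J"
    by (simp add: J_def)
  have eq: "(CLINT \<omega>|M. iexp (\<Sum>j\<in>J. t j * XJ j \<omega>)) = (CLINT \<omega>|N. iexp (\<Sum>j\<in>J. t j * YJ j \<omega>))" for t
  proof -
    define cs where "cs = map (\<lambda>k. \<chi> i. t (k, i)) [0..<m]"
    have len: "length cs = length ts"
      by (simp add: cs_def m_def)
    have sum: "(\<Sum>j\<in>J. t j * XJ j \<omega>) = (\<Sum>k<length ts. cs ! k \<bullet> X (ts ! k) \<omega>)"
        "(\<Sum>j\<in>J. t j * YJ j \<omega>') = (\<Sum>k<length ts. cs ! k \<bullet> Y (ts ! k) \<omega>')" for \<omega> \<omega>'
      unfolding J_def XJ_def YJ_def by (simp_all add: sum.cartesian_product' inner_vec_def cs_def m_def)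
    show ?thesis
      unfolding sum prob_space.centered_gaussian_rv_moments(2)[OF M gaussian_process_linear[OF M X len]]
        prob_space.centered_gaussian_rv_moments(2)[OF N gaussian_process_linear[OF N Y len]]
        gaussian_process_linear_variance[OF M X len] gaussian_process_linear_variance[OF N Y len] cov ..
  qed
  have h: "h \<in> measurable (PiM J (\<lambda>_. borel)) (PiM {..<m} (\<lambda>_. borel))"
    unfolding h_def
  proof (rule measurable_restrict)
    fix k assume "k \<in> {..<m}"
    then show "(\<lambda>f. (\<chi> i. f (k, i)) :: real^'n) \<in> borel_measurable (PiM J (\<lambda>_. borel))"
      by (subst borel_measurable_vec_iff) (auto simp: J_def intro!: measurable_component_singleton)
  qed
  have distr: "distr M (PiM J (\<lambda>_. borel)) (\<lambda>\<omega>. \<lambda>j\<in>J. XJ j \<omega>) = distr N (PiM J (\<lambda>_. borel)) (\<lambda>\<omega>. \<lambda>j\<in>J. YJ j \<omega>)"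
    by (rule cramer_wold[OF M N mJ J eq])
  have m: "(\<lambda>\<omega>. \<lambda>j\<in>J. XJ j \<omega>) \<in> measurable M (PiM J (\<lambda>_. borel))"
      "(\<lambda>\<omega>. \<lambda>j\<in>J. YJ j \<omega>) \<in> measurable N (PiM J (\<lambda>_. borel))"
    using mJ by (auto intro!: measurable_restrict)
  have "h \<circ> (\<lambda>\<omega>. \<lambda>j\<in>J. XJ j \<omega>) = (\<lambda>\<omega>. \<lambda>k\<in>{..<m}. X (ts ! k) \<omega>)"
      "h \<circ> (\<lambda>\<omega>. \<lambda>j\<in>J. YJ j \<omega>) = (\<lambda>\<omega>. \<lambda>k\<in>{..<m}. Y (ts ! k) \<omega>)"
    by (auto simp: fun_eq_iff h_def J_def XJ_def YJ_def vec_eq_iff restrict_def)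
  then show "distr M (Pi\<^sub>M {..<length ts} (\<lambda>_. borel)) (\<lambda>\<omega>. \<lambda>k\<in>{..<length ts}. X (ts ! k) \<omega>) =
     distr N (Pi\<^sub>M {..<length ts} (\<lambda>_. borel)) (\<lambda>\<omega>. \<lambda>k\<in>{..<length ts}. Y (ts ! k) \<omega>)"
    using arg_cong[OF distr, of "\<lambda>P. distr P (PiM {..<m} (\<lambda>_. borel)) h"]
    unfolding distr_distr[OF h m(1)] distr_distr[OF h m(2)] by (simp add: m_def)
qed

definition cov_matrix :: "'a measure \<Rightarrow> (real \<Rightarrow> 'a \<Rightarrow> real^'n) \<Rightarrow> real \<Rightarrow> real \<Rightarrow> real^'n^'n" where
  "cov_matrix M X t s = (\<chi> i j. LINT \<omega>|M. X t \<omega> $ i * X s \<omega> $ j)"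

lemma cov_matrix_linear_image:
  fixes X :: "real \<Rightarrow> 'a \<Rightarrow> real^'n" and C :: "real^'n^'m"
  assumes M: "prob_space M" and X: "centered_gaussian_process M X"
  shows "cov_matrix M (\<lambda>t \<omega>. C *v X t \<omega>) t s = C ** cov_matrix M X t s ** transpose C"
proof -
  note int = gaussian_process_prod_integrable[OF M X]
  have "(LINT \<omega>|M. (C *v X t \<omega>) $ i * (C *v X s \<omega>) $ j) = (C ** cov_matrix M X t s ** transpose C) $ i $ j" for i j
  proof -
    have "(C *v X t \<omega>) $ i * (C *v X s \<omega>) $ j
        = (\<Sum>l\<in>UNIV. \<Sum>k\<in>UNIV. C $ i $ k * C $ j $ l * (X t \<omega> $ k * X s \<omega> $ l))" for \<omega>
      unfolding matrix_vector_mult_def vec_lambda_beta sum_distrib_left sum_distrib_right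
      by (intro sum.cong refl) (simp add: ac_simps)
    then have "(LINT \<omega>|M. (C *v X t \<omega>) $ i * (C *v X s \<omega>) $ j)
        = (\<Sum>l\<in>UNIV. \<Sum>k\<in>UNIV. C $ i $ k * C $ j $ l * (LINT \<omega>|M. X t \<omega> $ k * X s \<omega> $ l))"
      using int by simp
    then show ?thesis
      unfolding matrix_matrix_mult_def cov_matrix_def transpose_def
      by (simp add: sum_distrib_left sum_distrib_right ac_simps)
  qed
  then show ?thesis
    by (simp add: vec_eq_iff cov_matrix_def[of M "\<lambda>t \<omega>. C *v X t \<omega>"])
qed

lemma fdd_eq_iff_cov_matrix:
  fixes X :: "real \<Rightarrow> 'a \<Rightarrow> real^'n" and Y :: "real \<Rightarrow> 'b \<Rightarrow> real^'n"
  assumes M: "prob_space M" and N: "prob_space N"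
    and X: "centered_gaussian_process M X" and Y: "centered_gaussian_process N Y"
  shows "fdd_eq M X N Y \<longleftrightarrow> (\<forall>t s. cov_matrix M X t s = cov_matrix N Y t s)"
  using fdd_eq_imp_cov_eq[of X M Y N, OF gaussian_process_measurable[OF M X] gaussian_process_measurable[OF N Y]]
    gaussian_fdd_eqI[OF M N X Y]
  by (auto simp: cov_matrix_def vec_eq_iff)

section \<open>Matrix exponentials\<close>

lemma mpow_0 [simp]: "mpow M 0 = mat 1"
  and mpow_Suc: "mpow M (Suc k) = M ** mpow M k"
  by (simp_all add: mpow_def)

lemma mpow_Suc': "mpow M (Suc k) = mpow M k ** M"
  by (induction k) (simp_all add: mpow_Suc matrix_mul_assoc)

lemma scaleR_matrix_mult: "(r *\<^sub>R A) ** (B :: real^'m^'n) = r *\<^sub>R (A ** B)" for A :: "real^'n^'l"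
  by (simp add: matrix_matrix_mult_def vec_eq_iff sum_distrib_left mult.assoc)

lemma matrix_mult_scaleR: "A ** (r *\<^sub>R B) = r *\<^sub>R (A ** (B :: real^'m^'n))" for A :: "real^'n^'l"
  by (simp add: matrix_matrix_mult_def vec_eq_iff sum_distrib_left mult.left_commute)

lemma mpow_scaleR: "mpow (s *\<^sub>R M) k = s ^ k *\<^sub>R mpow M k" for M :: "real^'n^'n"
  by (induction k) (simp_all add: mpow_Suc scaleR_matrix_mult matrix_mult_scaleR)

text \<open>Any geometric bound will do, since the factorials in the exponential series beat
  it.\<close>

lemma mpow_entry_bound:
  fixes M :: "real^'n^'n"
  shows "\<bar>mpow M k $ i $ j\<bar> \<le> (\<Sum>i\<in>UNIV. \<Sum>j\<in>UNIV. \<bar>M $ i $ j\<bar>) ^ k"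
proof (induction k arbitrary: i)
  case 0
  then show ?case by (simp add: mat_def)
next
  case (Suc k)
  let ?K = "\<Sum>i\<in>UNIV. \<Sum>j\<in>UNIV. \<bar>M $ i $ j\<bar>"
  have "\<bar>mpow M (Suc k) $ i $ j\<bar> \<le> (\<Sum>l\<in>UNIV. \<bar>M $ i $ l\<bar> * \<bar>mpow M k $ l $ j\<bar>)"
    unfolding mpow_Suc matrix_matrix_mult_def by (simp flip: abs_mult add: sum_abs)
  also have "\<dots> \<le> (\<Sum>l\<in>UNIV. \<bar>M $ i $ l\<bar>) * ?K ^ k"
    unfolding sum_distrib_right by (intro sum_mono mult_left_mono Suc.IH) simp
  also have "\<dots> \<le> ?K * ?K ^ k"
    by (intro mult_right_mono zero_le_power sum_nonneg member_le_sum[of i UNIV "\<lambda>i. \<Sum>j\<in>UNIV. \<bar>M $ i $ j\<bar>"])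
      (auto intro: sum_nonneg)
  finally show ?case by simp
qed

lemma mexp_entry_summable:
  fixes M :: "real^'n^'n"
  shows "summable (\<lambda>k. mpow M k $ i $ j / fact k * s ^ k)"
proof (rule summable_comparison_test')
  define K where "K = (\<Sum>i\<in>UNIV. \<Sum>j\<in>UNIV. \<bar>M $ i $ j\<bar>)"
  show "summable (\<lambda>k. inverse (fact k) * (K * \<bar>s\<bar>) ^ k)"
    by (rule summable_exp)
  show "norm (mpow M k $ i $ j / fact k * s ^ k) \<le> inverse (fact k) * (K * \<bar>s\<bar>) ^ k" for k
    using mult_right_mono[OF mpow_entry_bound[of M k i j], of "\<bar>s\<bar> ^ k"]
    by (simp add: K_def[symmetric] abs_mult power_abs power_mult_distrib field_simps)
qed

lemma mexp_entry: "mexp (s *\<^sub>R M) $ i $ j = (\<Sum>k. mpow M k $ i $ j / fact k * s ^ k)"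
  for M :: "real^'n^'n"
proof -
  define f where "f k = (1 / fact k) *\<^sub>R mpow (s *\<^sub>R M) k" for k
  have f: "f k $ i $ j = mpow M k $ i $ j / fact k * s ^ k" for k i j
    by (simp add: f_def mpow_scaleR)
  have "f sums (\<chi> i j. \<Sum>k. f k $ i $ j)"
    unfolding sums_def
  proof (intro vec_tendstoI)
    fix i j
    have "(\<lambda>n. \<Sum>k<n. f k $ i $ j) \<longlonglongrightarrow> (\<Sum>k. f k $ i $ j)"
      using summable_sums[OF mexp_entry_summable[of M i j s]] by (simp only: f sums_def)
    then show "(\<lambda>n. sum f {..<n} $ i $ j) \<longlonglongrightarrow> (\<chi> i j. \<Sum>k. f k $ i $ j) $ i $ j"
      by simp
  qed
  then show ?thesis
    unfolding mexp_def f_def[symmetric] by (simp add: sums_unique[symmetric] f)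
qed

lemma mexp_zero: "mexp (0 *\<^sub>R M) = mat 1"
  unfolding vec_eq_iff mexp_entry by (simp only: powser_zero) simp

text \<open>Multiplying by \<open>M\<close> on the left or on the right writes an entry of M^(k+1)
  as a fixed combination of entries of M^k. The parameters \<open>a\<close>, \<open>p\<close>,
  \<open>q\<close> treat both at once, by termwise differentiation.\<close>

lemma mexp_has_derivative_aux:
  fixes M :: "real^'n^'n" and a :: "'n \<Rightarrow> real"
  assumes "\<And>k. mpow M (Suc k) $ i $ j = (\<Sum>l\<in>UNIV. a l * mpow M k $ p l $ q l)"
  shows "((\<lambda>s. mexp (s *\<^sub>R M) $ i $ j) has_real_derivative
    (\<Sum>l\<in>UNIV. a l * mexp (s *\<^sub>R M) $ p l $ q l)) (at s)"
proof -
  let ?c = "\<lambda>k. mpow M k $ i $ j / fact k"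
  have "diffs ?c k * s ^ k = (\<Sum>l\<in>UNIV. a l * (mpow M k $ p l $ q l / fact k * s ^ k))" for k
  proof -
    have "diffs ?c k = mpow M (Suc k) $ i $ j / fact k"
      by (simp add: diffs_def)
    then show ?thesis
      unfolding assms by (simp add: sum_distrib_right sum_divide_distrib mult.assoc)
  qed
  then have "(\<Sum>k. diffs ?c k * s ^ k)
      = (\<Sum>l\<in>UNIV. \<Sum>k. a l * (mpow M k $ p l $ q l / fact k * s ^ k))"
    by (simp only:) (intro suminf_sum summable_mult mexp_entry_summable)
  also have "\<dots> = (\<Sum>l\<in>UNIV. a l * mexp (s *\<^sub>R M) $ p l $ q l)"
    unfolding mexp_entry by (intro sum.cong refl suminf_mult mexp_entry_summable)
  finally have "(\<Sum>k. diffs ?c k * s ^ k) = (\<Sum>l\<in>UNIV. a l * mexp (s *\<^sub>R M) $ p l $ q l)" .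
  then show ?thesis
    using termdiffs_strong_converges_everywhere[of ?c s] mexp_entry_summable[of M i j]
    unfolding mexp_entry by simp
qed

lemma mexp_has_derivative_left:
  "((\<lambda>s. mexp (s *\<^sub>R M) $ i $ j) has_real_derivative (M ** mexp (s *\<^sub>R M)) $ i $ j) (at s)"
  unfolding matrix_matrix_mult_def vec_lambda_beta
  by (rule mexp_has_derivative_aux) (simp add: mpow_Suc matrix_matrix_mult_def)

lemma mexp_has_derivative_right:
  "((\<lambda>s. mexp (s *\<^sub>R M) $ i $ j) has_real_derivative (mexp (s *\<^sub>R M) ** M) $ i $ j) (at s)"
proof -
  have *: "(mexp (s *\<^sub>R M) ** M) $ i $ j = (\<Sum>l\<in>UNIV. M $ l $ j * mexp (s *\<^sub>R M) $ i $ l)"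
    by (simp add: matrix_matrix_mult_def mult.commute)
  show ?thesis
    unfolding * by (rule mexp_has_derivative_aux) (simp add: mpow_Suc' matrix_matrix_mult_def mult.commute)
qed

section \<open>Growth of the matrix exponential from the spectrum\<close>

definition root_factor :: "complex^'n^'n \<Rightarrow> complex \<Rightarrow> complex^'n \<Rightarrow> complex^'n" where
  "root_factor T l v = T *v v - l *s v"

lemma root_factor_commute: "root_factor T l (root_factor T m v) = root_factor T m (root_factor T l v)"
  by (simp add: root_factor_def matrix_vector_mult_diff_distrib vector_scalar_commute
      vector_ssub_ldistrib vector_smult_assoc mult.commute)

lemma fold_root_factor_commute:
  "fold (root_factor T) L (root_factor T l v) = root_factor T l (fold (root_factor T) L v)"
  by (induction L arbitrary: v) (simp, metis fold_simps(2) root_factor_commute)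

text \<open>Multiplying a polynomial by X - l shifts its coefficients and subtracts l times them,
  which is one application of \<open>root_factor\<close>. Any bound \<open>n\<close> on the degree
  is allowed, so that the sum matches the linear relation in
  \<open>ex_annihilating_roots\<close>.\<close>

lemma poly_eq_fold_root_factor:
  assumes "length L \<le> n"
  shows "(\<Sum>i\<le>n. coeff (\<Prod>l\<leftarrow>L. [:-l, 1:]) i *s ((*v) T ^^ i) v) = fold (root_factor T) L v"
  using assms
proof (induction L arbitrary: n v)
  case Nil
  then show ?case
    by (simp add: sum.atMost_shift)
next
  case (Cons l L)
  then obtain m where n: "n = Suc m" and m: "length L \<le> m"
    by (cases n) auto
  define q where "q = (\<Prod>l\<leftarrow>L. [:-l, 1:])"
  have deg: "degree q \<le> m"
    using m order_trans[OF degree_prod_list_le[of "map (\<lambda>l. [:-l, 1:]) L"]]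
    by (simp add: q_def o_def sum_list_triv)
  have lin: "((*v) T ^^ i) (root_factor T l v) = ((*v) T ^^ Suc i) v - l *s ((*v) T ^^ i) v" for i
    by (induction i) (simp_all add: root_factor_def matrix_vector_mult_diff_distrib vector_scalar_commute)
  have "(\<Sum>i\<le>n. coeff ([:-l, 1:] * q) i *s ((*v) T ^^ i) v)
      = (\<Sum>i\<le>n. coeff (pCons 0 q) i *s ((*v) T ^^ i) v) - (\<Sum>i\<le>n. (l * coeff q i) *s ((*v) T ^^ i) v)"
    by (simp add: vector_sadd_rdistrib vector_ssub_ldistrib sum.distrib sum_negf algebra_simps flip: sum_subtractf)
  also have "(\<Sum>i\<le>n. coeff (pCons 0 q) i *s ((*v) T ^^ i) v) = (\<Sum>i\<le>m. coeff q i *s ((*v) T ^^ Suc i) v)"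
    unfolding n by (subst sum.atMost_Suc_shift) simp
  also have "(\<Sum>i\<le>n. (l * coeff q i) *s ((*v) T ^^ i) v) = (\<Sum>i\<le>m. coeff q i *s (l *s ((*v) T ^^ i) v))"
    unfolding n using deg by (simp add: coeff_eq_0 vector_smult_assoc mult.commute)
  also have "(\<Sum>i\<le>m. coeff q i *s ((*v) T ^^ Suc i) v) - \<dots> = (\<Sum>i\<le>m. coeff q i *s ((*v) T ^^ i) (root_factor T l v))"
    unfolding lin by (simp add: vector_ssub_ldistrib sum_subtractf)
  also have "\<dots> = fold (root_factor T) L (root_factor T l v)"
    unfolding q_def by (rule Cons.IH[OF m])
  finally show ?case
    by (simp add: q_def)
qed

lemma scaleR_eq_smult: "r *\<^sub>R v = complex_of_real r *s v"
  by (simp add: vec_eq_iff scaleR_conv_of_real[where 'a = complex])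

text \<open>Sufficiently many iterates of T on v satisfy a linear relation. It is a polynomial in T
  killing v, and it splits into linear factors over the complex numbers.\<close>

lemma ex_annihilating_roots:
  fixes T :: "complex^'n^'n"
  obtains L where "fold (root_factor T) L v = 0"
proof -
  \<comment> \<open>This is the real dimension, twice the number of coordinates, because
    \<open>dependent\<close> is real linear dependence.\<close>
  define N where "N = DIM(complex^'n)"
  let ?w = "\<lambda>i. ((*v) T ^^ i) v"
  obtain a :: "nat \<Rightarrow> real" and i where i: "i \<le> N" "a i \<noteq> 0" and a: "(\<Sum>i\<le>N. a i *\<^sub>R ?w i) = 0"
  \<comment> \<open>Dependence is a property of sets and does not see repeated iterates. A
    repetition is itself a relation, with coefficients 1 and -1.\<close>
  proof (cases "inj_on ?w {..N}")
    case True
    then have "card (?w ` {..N}) = N + 1"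
      by (simp add: card_image)
    then have "dependent (?w ` {..N})"
      using independent_bound[of "?w ` {..N}"] by (auto simp: N_def)
    then obtain u x where "x \<in> ?w ` {..N}" "u x \<noteq> 0" "(\<Sum>x\<in>?w ` {..N}. u x *\<^sub>R x) = 0"
      by (auto simp: dependent_finite)
    with True show ?thesis
      by (auto simp: sum.reindex intro!: that[of _ "u \<circ> ?w"])
  next
    case False
    then obtain i j where ij: "i \<le> N" "j \<le> N" "i \<noteq> j" "?w i = ?w j"
      by (auto simp: inj_on_def)
    define a where "a k = (if k = i then 1 else if k = j then - 1 else 0 :: real)" for k
    have "(\<Sum>k\<le>N. a k *\<^sub>R ?w k) = (\<Sum>k\<in>{i, j}. a k *\<^sub>R ?w k)"
      by (rule sum.mono_neutral_right) (use ij in \<open>auto simp: a_def\<close>)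
    also have "\<dots> = 0"
      using ij by (simp add: a_def)
    finally show ?thesis
      using ij by (intro that[of i a]) (auto simp: a_def)
  qed
  define p where "p = (\<Sum>i\<le>N. monom (complex_of_real (a i)) i)"
  have coeff: "coeff p k = (if k \<le> N then of_real (a k) else 0)" for k
    by (simp add: p_def coeff_sum)
  have "p \<noteq> 0"
    using i coeff[of i] by auto
  have deg: "degree p \<le> N"
    by (rule degree_le) (simp add: coeff)
  obtain L where L: "mset L = proots p"
    using ex_mset by blast
  have len: "length L \<le> N"
    using deg L size_proots_complex[of p] by (metis size_mset)
  have p: "p = smult (lead_coeff p) (\<Prod>l\<leftarrow>L. [:-l, 1:])"
    using complex_poly_decompose_multiset[of p] by (simp flip: L prod_mset_prod_list mset_map)
  have "0 = (\<Sum>i\<le>N. coeff p i *s ?w i)"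
    unfolding a[symmetric] by (intro sum.cong) (simp_all add: coeff scaleR_eq_smult)
  also have "\<dots> = lead_coeff p *s (\<Sum>i\<le>N. coeff (\<Prod>l\<leftarrow>L. [:-l, 1:]) i *s ?w i)"
    by (subst p) (simp add: vec.scale_sum_right vector_smult_assoc)
  also have "\<dots> = lead_coeff p *s fold (root_factor T) L v"
    unfolding poly_eq_fold_root_factor[OF len] ..
  finally show ?thesis
    using \<open>p \<noteq> 0\<close> by (intro that[of L]) auto
qed


text \<open>Every vector is annihilated by a product of factors \<open>D - l\<close>. Factors with \<open>l\<close> not an eigenvalue can be
  dropped, and each remaining factor is undone by integrating the equation \<open>y' = l y + w\<close>.\<close>

definition exp_bounded :: "real^'n^'n \<Rightarrow> real \<Rightarrow> complex^'n \<Rightarrow> bool" where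
  "exp_bounded D a v \<longleftrightarrow> (\<exists>b<a. \<exists>C. \<forall>s\<ge>0. \<forall>i. cmod ((cmat (mexp (s *\<^sub>R D)) *v v) $ i) \<le> C * exp (b * s))"

lemma exp_orbit_has_derivative:
  fixes D :: "real^'n^'n"
  shows "((\<lambda>s. (cmat (mexp (s *\<^sub>R D)) *v v) $ i) has_vector_derivative
    (cmat (mexp (s *\<^sub>R D)) *v (cmat D *v v)) $ i) (at s)"
proof -
  have "((\<lambda>s. \<Sum>j\<in>UNIV. complex_of_real (mexp (s *\<^sub>R D) $ i $ j) * v $ j) has_vector_derivative
    (\<Sum>j\<in>UNIV. complex_of_real ((mexp (s *\<^sub>R D) ** D) $ i $ j) * v $ j)) (at s)"
    by (intro has_vector_derivative_sum has_vector_derivative_mult_left has_vector_derivative_of_real)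
      (use mexp_has_derivative_right in \<open>simp add: has_real_derivative_iff_has_vector_derivative\<close>)
  moreover have "cmat (mexp (s *\<^sub>R D)) *v (cmat D *v v) = cmat (mexp (s *\<^sub>R D) ** D) *v v"
    unfolding matrix_vector_mul_assoc by (simp add: cmat_def matrix_matrix_mult_def vec_eq_iff)
  ultimately show ?thesis
    by (simp add: matrix_vector_mult_def cmat_def)
qed

lemma exp_bounded_step:
  fixes D :: "real^'n^'n"
  assumes w: "exp_bounded D a (root_factor (cmat D) l v)" and l: "Re l < a"
  shows "exp_bounded D a v"
proof -
  define w where "w = root_factor (cmat D) l v"
  define E where "E s = cmat (mexp (s *\<^sub>R D))" for s
  from w obtain b0 C where b0: "b0 < a" and C: "\<And>s i. s \<ge> 0 \<Longrightarrow> cmod ((E s *v w) $ i) \<le> C * exp (b0 * s)"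
    unfolding exp_bounded_def w_def E_def by blast
  \<comment> \<open>The new rate lies strictly above both old ones: if they coincide, the solution
    can carry an extra factor s, which the slack absorbs.\<close>
  obtain b where b: "max b0 (Re l) < b" "b < a"
    using dense[of "max b0 (Re l)" a] b0 l by auto
  have "0 \<le> C"
    using C[of 0 undefined] order_trans[OF norm_ge_zero] by fastforce
  have Cb: "cmod ((E s *v w) $ i) \<le> C * exp (b * s)" if "s \<ge> 0" for s i
    using C[OF that, of i] b \<open>0 \<le> C\<close> that
    by (elim order_trans) (intro mult_left_mono, auto intro: mult_right_mono)
  define \<beta> where "\<beta> = b - Re l"
  have \<beta>: "\<beta> > 0"
    using b by (simp add: \<beta>_def)
  define V where "V = (\<Sum>i\<in>UNIV. cmod (v $ i))"
  have "cmod ((E s *v v) $ i) \<le> (V + C / \<beta>) * exp (b * s)" if "s \<ge> 0" for s i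
  proof -
    \<comment> \<open>The integrating factor exp(-l s) leaves a derivative that involves only
      \<open>w\<close>. \<open>\<phi>\<close> is an antiderivative of the bound on that derivative,
      and the mean value inequality compares increments of the two.\<close>
    define z where "z s = exp (of_real s * (- l)) * (E s *v v) $ i" for s
    define \<phi> where "\<phi> s = C * exp (\<beta> * s) / \<beta>" for s
    have z': "(z has_vector_derivative exp (of_real s * (- l)) * (E s *v w) $ i) (at s)" for s
    proof -
      have e: "((\<lambda>s. exp (of_real s * (- l))) has_vector_derivative (exp (of_real s * (- l)) * (- l))) (at s)"
        by (rule has_vector_derivative_real_field) (auto intro!: derivative_eq_intros)
      have "E s *v (cmat D *v v) = E s *v w + l *s (E s *v v)"
        unfolding w_def root_factor_def
        by (simp add: matrix_vector_mult_diff_distrib vector_scalar_commute)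
      then show ?thesis
        unfolding z_def
        using has_vector_derivative_mult[OF e exp_orbit_has_derivative[of D v i s, folded E_def]]
        by (simp add: algebra_simps)
    qed
    have \<phi>': "(\<phi> has_vector_derivative C * exp (\<beta> * s)) (at s)" for s
      unfolding \<phi>_def has_real_derivative_iff_has_vector_derivative[symmetric]
      using \<beta> by (auto intro!: derivative_eq_intros)
    have bnd: "cmod (exp (of_real s * (- l)) * (E s *v w) $ i) \<le> C * exp (\<beta> * s)" if "s \<ge> 0" for s
    proof -
      have "cmod (exp (of_real s * (- l)) * (E s *v w) $ i) = exp (- (s * Re l)) * cmod ((E s *v w) $ i)"
        by (simp add: norm_mult)
      also have "\<dots> \<le> exp (- (s * Re l)) * (C * exp (b * s))"
        by (intro mult_left_mono Cb that) simp
      also have "\<dots> = C * exp (\<beta> * s)"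
        by (simp add: \<beta>_def algebra_simps flip: exp_add)
      finally show ?thesis .
    qed
    have "cmod (z s - z 0) \<le> \<phi> s - \<phi> 0"
    proof (cases "s = 0")
      case False
      have "continuous_on {0..s} z" "continuous_on {0..s} \<phi>"
        using z' \<phi>' by (meson continuous_at_imp_continuous_on has_vector_derivative_continuous)+
      then show ?thesis
        using False that bnd z' \<phi>' by (intro differentiable_bound_general) auto
    qed simp
    moreover have "z 0 = v $ i"
      by (simp add: z_def E_def mexp_zero cmat_def matrix_vector_mult_def mat_def
          if_distrib[of "\<lambda>c. c * _"] if_distrib[of complex_of_real] cong: if_cong del: scale_zero_left)
    moreover have "\<phi> 0 \<ge> 0"
      using \<beta> \<open>0 \<le> C\<close> by (simp add: \<phi>_def)
    moreover have "cmod (v $ i) \<le> V"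
      unfolding V_def by (intro member_le_sum) auto
    ultimately have z: "cmod (z s) \<le> V + C * exp (\<beta> * s) / \<beta>"
      using norm_triangle_ineq2[of "z s" "z 0"] by (simp add: \<phi>_def)
    have "V \<ge> 0"
      unfolding V_def by (intro sum_nonneg) simp
    have "V + C * exp (\<beta> * s) / \<beta> \<le> V * exp (\<beta> * s) + C * exp (\<beta> * s) / \<beta>"
      using that \<beta> \<open>V \<ge> 0\<close> by (simp add: mult_le_cancel_left1)
    with z have z: "cmod (z s) \<le> (V + C / \<beta>) * exp (\<beta> * s)"
      by (simp add: algebra_simps)
    have "cmod ((E s *v v) $ i) = exp (s * Re l) * cmod (z s)"
      unfolding z_def by (simp add: norm_mult flip: exp_add mult.assoc)
    also have "\<dots> \<le> exp (s * Re l) * ((V + C / \<beta>) * exp (\<beta> * s))"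
      using z by simp
    also have "\<dots> = (V + C / \<beta>) * exp (b * s)"
      by (simp add: \<beta>_def algebra_simps flip: exp_add)
    finally show ?thesis .
  qed
  then show ?thesis
    unfolding exp_bounded_def E_def using b by blast
qed

lemma exp_bounded_all:
  fixes D :: "real^'n^'n"
  assumes eig: "\<forall>l v. v \<noteq> 0 \<longrightarrow> cmat D *v v = l *s v \<longrightarrow> Re l < a"
  shows "exp_bounded D a v"
proof -
  have "exp_bounded D a v" if "fold (root_factor (cmat D)) L v = 0" for L
    using that
  proof (induction L arbitrary: v)
    case Nil
    have "a - 1 < a" by simp
    with Nil show ?case
      unfolding exp_bounded_def by (intro exI[of _ "a - 1"]) (auto intro!: exI[of _ 0])
  next
    case (Cons l L)
    show ?case
    proof (cases "Re l < a")
      case True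
      then show ?thesis
        using Cons.prems by (intro exp_bounded_step[OF Cons.IH]) simp_all
    next
      case False
      \<comment> \<open>Since the factors commute, this one can be moved outermost, where its
        trivial kernel lets it be cancelled.\<close>
      have "root_factor (cmat D) l (fold (root_factor (cmat D)) L v) = 0"
        using Cons.prems by (simp add: fold_root_factor_commute)
      then have "fold (root_factor (cmat D)) L v = 0"
        using eig False by (auto simp: root_factor_def)
      then show ?thesis
        by (rule Cons.IH)
    qed
  qed
  then show ?thesis
    using ex_annihilating_roots[of "cmat D" v] by blast
qed

lemma mexp_growth_nonneg:
  fixes D :: "real^'n^'n"
  assumes eig: "\<forall>l v. v \<noteq> 0 \<longrightarrow> cmat D *v v = l *s v \<longrightarrow> Re l < a" and "0 < a"
  obtains b C where "0 \<le> b" "b < a" "0 \<le> C" "\<And>s i j. s \<ge> 0 \<Longrightarrow> \<bar>mexp (s *\<^sub>R D) $ i $ j\<bar> \<le> C * exp (b * s)"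
proof -
  have col: "(cmat X *v axis j 1) $ i = of_real (X $ i $ j)" for X :: "real^'n^'n" and i j
    by (simp add: matrix_vector_mult_def cmat_def axis_def if_distrib[of "\<lambda>c. _ * c"] cong: if_cong)
  have "\<exists>b C. b < a \<and> (\<forall>s\<ge>0. \<forall>i. \<bar>mexp (s *\<^sub>R D) $ i $ j\<bar> \<le> C * exp (b * s))" for j
    using exp_bounded_all[OF eig, of "axis j 1"] unfolding exp_bounded_def col norm_of_real by blast
  then obtain b C where bC: "\<And>j. b j < a"
      "\<And>j s i. s \<ge> 0 \<Longrightarrow> \<bar>mexp (s *\<^sub>R D) $ i $ j\<bar> \<le> C j * exp (b j * s)"
    by metis
  \<comment> \<open>Inserting 0 makes the common exponent nonnegative; \<open>0 < a\<close> keeps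
    the maximum below \<open>a\<close>.\<close>
  define b' where "b' = Max (insert 0 (range b))"
  define C' where "C' = (\<Sum>j\<in>UNIV. \<bar>C j\<bar>)"
  have b': "0 \<le> b'" "b j \<le> b'" for j
    unfolding b'_def by (intro Max_ge; simp)+
  have b'_less: "b' < a"
    using bC(1) \<open>0 < a\<close> by (auto simp: b'_def)
  have "0 \<le> C'"
    unfolding C'_def by (intro sum_nonneg) simp
  moreover have "C j \<le> C'" for j
    using member_le_sum[of j UNIV "\<lambda>j. \<bar>C j\<bar>"] by (simp add: C'_def)
  ultimately have C': "0 \<le> C'" "C j \<le> C'" for j
    by simp_all
  have "\<bar>mexp (s *\<^sub>R D) $ i $ j\<bar> \<le> C' * exp (b' * s)" if "s \<ge> 0" for s i j
  proof -
    have "\<bar>mexp (s *\<^sub>R D) $ i $ j\<bar> \<le> C j * exp (b j * s)"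
      by (rule bC(2)[OF that])
    also have "\<dots> \<le> C' * exp (b' * s)"
      using b' C' that by (intro mult_mono) (auto intro: mult_right_mono)
    finally show ?thesis .
  qed
  with b' b'_less C' show ?thesis
    by (intro that[of b' C']) auto
qed

lemma eigenvalue_in_char_roots:
  assumes "v \<noteq> 0" "cmat D *v v = l *s v"
  shows "l \<in> char_roots D"
proof -
  have "mat l *v v = l *s v"
    by (simp add: matrix_vector_mult_def mat_def vec_eq_iff if_distrib[of "\<lambda>c. c * _"] cong: if_cong)
  then have "(mat l - cmat D) *v v = 0"
    using assms(2) by (simp add: matrix_vector_mult_diff_rdistrib)
  then have "\<not> invertible (mat l - cmat D)"
    using assms(1) matrix_left_invertible_ker[of "mat l - cmat D"] invertible_left_inverse by blast
  then show ?thesis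
    by (simp add: char_roots_def invertible_det_nz)
qed

text \<open>Negative s is positive time for \<open>- D\<close>, whose eigenvalues are the negatives;
  here the lower bound on the characteristic roots is used.\<close>

lemma mexp_growth:
  fixes D :: "real^'n^'n"
  assumes "\<forall>z\<in>char_roots D. - a < Re z \<and> Re z < a" and "0 < a"
  obtains b C where "0 \<le> b" "b < a" "0 \<le> C" "\<And>s i j. \<bar>mexp (s *\<^sub>R D) $ i $ j\<bar> \<le> C * exp (b * \<bar>s\<bar>)"
proof -
  have pos: "Re l < a" if "v \<noteq> 0" "cmat D *v v = l *s v" for l v
    using eigenvalue_in_char_roots[OF that] assms(1) by auto
  have neg: "Re l < a" if "v \<noteq> 0" "cmat (- D) *v v = l *s v" for l v
  proof -
    have "cmat D *v v = (- l) *s v"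
      using that(2) by (simp add: cmat_def matrix_vector_mult_def vec_eq_iff sum_negf minus_equation_iff[of _ "_ * _"] flip: minus_mult_left)
    then have "- l \<in> char_roots D"
      by (rule eigenvalue_in_char_roots[OF that(1)])
    then show ?thesis
      using assms(1) by force
  qed
  obtain b1 C1 where 1: "0 \<le> b1" "b1 < a" "0 \<le> C1" "\<And>s i j. s \<ge> 0 \<Longrightarrow> \<bar>mexp (s *\<^sub>R D) $ i $ j\<bar> \<le> C1 * exp (b1 * s)"
    using mexp_growth_nonneg[of D a] pos \<open>0 < a\<close> by metis
  obtain b2 C2 where 2: "0 \<le> b2" "b2 < a" "0 \<le> C2" "\<And>s i j. s \<ge> 0 \<Longrightarrow> \<bar>mexp (s *\<^sub>R (- D)) $ i $ j\<bar> \<le> C2 * exp (b2 * s)"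
    using mexp_growth_nonneg[of "- D" a] neg \<open>0 < a\<close> by metis
  have "\<bar>mexp (s *\<^sub>R D) $ i $ j\<bar> \<le> max C1 C2 * exp (max b1 b2 * \<bar>s\<bar>)" for s i j
  proof (cases "s \<ge> 0")
    case True
    have "C1 * exp (b1 * s) \<le> max C1 C2 * exp (max b1 b2 * s)"
      using True 1 by (intro mult_mono) (auto intro: mult_right_mono)
    with 1(4)[OF True, of i j] True show ?thesis by simp
  next
    case False
    have "C2 * exp (b2 * - s) \<le> max C1 C2 * exp (max b1 b2 * - s)"
      using False 2 by (intro mult_mono) (auto intro: mult_right_mono simp del: mult_minus_right)
    with 2(4)[of "- s" i j] False show ?thesis by simp
  qed
  with 1 2 show ?thesis
    by (intro that[of "max b1 b2" "max C1 C2"]) auto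
qed

section \<open>The spectral density\<close>

abbreviation spectral_matrix :: "real^'n^'n \<Rightarrow> complex^'n^'n \<Rightarrow> real \<Rightarrow> complex^'n^'n" where
  "spectral_matrix D A x \<equiv> ofbm_kernel D A x ** adjoint_mat (ofbm_kernel D A x)"

lemma adjoint_mat_mult: "adjoint_mat (A ** B) = adjoint_mat B ** adjoint_mat A"
  by (simp add: adjoint_mat_def mconj_def matrix_transpose_mul[symmetric])
    (simp add: transpose_def matrix_matrix_mult_def vec_eq_iff mult.commute)

lemma adjoint_mat_cmat: "adjoint_mat (cmat E) = transpose (cmat E)"
  by (simp add: adjoint_mat_def mconj_def cmat_def)

lemma mconj_mult: "mconj (A ** B) = mconj A ** mconj B"
  by (simp add: mconj_def matrix_matrix_mult_def vec_eq_iff)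

lemma mconj_adjoint_mat: "mconj (adjoint_mat A) = adjoint_mat (mconj A)"
  by (simp add: mconj_def adjoint_mat_def transpose_def)

lemma spectral_matrix_zero: "spectral_matrix D A 0 = 0"
  by (simp add: ofbm_kernel_def mpowr_neg_def cmat_def matrix_matrix_mult_def vec_eq_iff)

text \<open>Away from 0 only one of the two halves of the kernel survives. The matrix power is real,
  so passing to negative frequencies merely conjugates \<open>A\<close>.\<close>

lemma spectral_matrix_nonzero:
  fixes D :: "real^'n^'n" and A :: "complex^'n^'n"
  assumes "x \<noteq> 0"
  defines "E \<equiv> cmat (mexp ((- ln \<bar>x\<bar>) *\<^sub>R D))" and "Q \<equiv> A ** adjoint_mat A"
  shows "spectral_matrix D A x = E ** (if x > 0 then Q else mconj Q) ** transpose E"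
proof -
  define P where "P = (if x > 0 then A else mconj A)"
  have 0: "cmat (0 :: real^'n^'n) ** X = 0" for X :: "complex^'n^'n"
    by (simp add: cmat_def matrix_matrix_mult_def vec_eq_iff)
  have K: "ofbm_kernel D A x = E ** P"
    using assms(1) by (auto simp: ofbm_kernel_def mpowr_neg_def P_def E_def 0 max_def)
  have "P ** adjoint_mat P = (if x > 0 then Q else mconj Q)"
    by (simp add: P_def Q_def mconj_mult mconj_adjoint_mat)
  then show ?thesis
    unfolding K adjoint_mat_mult by (simp add: E_def adjoint_mat_cmat matrix_mul_assoc[symmetric]) (simp add: matrix_mul_assoc)
qed

lemma spectral_matrix_entry:
  fixes D :: "real^'n^'n" and A :: "complex^'n^'n"
  assumes "x \<noteq> 0"
  defines "E \<equiv> mexp ((- ln \<bar>x\<bar>) *\<^sub>R D)" and "Q \<equiv> A ** adjoint_mat A"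
  shows "spectral_matrix D A x $ i $ j
    = (\<Sum>l\<in>UNIV. \<Sum>k\<in>UNIV. of_real (E $ i $ k * E $ j $ l) * (if x > 0 then Q $ k $ l else cnj (Q $ k $ l)))"
  unfolding spectral_matrix_nonzero[OF assms(1)] E_def[symmetric] Q_def[symmetric]
  by (cases "x > 0") (simp_all add: matrix_matrix_mult_def transpose_def cmat_def mconj_def
      sum_distrib_right sum_distrib_left ac_simps)

lemma mexp_log_measurable [measurable]:
  "(\<lambda>x. mexp ((- ln \<bar>x\<bar>) *\<^sub>R D) $ i $ j) \<in> borel_measurable borel"
proof -
  have "continuous_on UNIV (\<lambda>s. mexp (s *\<^sub>R D) $ i $ j)"
    using mexp_has_derivative_left DERIV_isCont by (intro continuous_at_imp_continuous_on) blast
  then have "(\<lambda>s. mexp (s *\<^sub>R D) $ i $ j) \<in> borel_measurable borel"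
    by (rule borel_measurable_continuous_onI)
  then show ?thesis
    by (rule measurable_compose[rotated]) measurable
qed

lemma spectral_matrix_measurable [measurable]:
  "(\<lambda>x. spectral_matrix D A x $ i $ j) \<in> borel_measurable borel"
proof -
  define Q where "Q = A ** adjoint_mat A"
  have "(\<lambda>x. spectral_matrix D A x $ i $ j) = (\<lambda>x. if x = 0 then 0 else \<Sum>l\<in>UNIV. \<Sum>k\<in>UNIV.
      of_real (mexp ((- ln \<bar>x\<bar>) *\<^sub>R D) $ i $ k * mexp ((- ln \<bar>x\<bar>) *\<^sub>R D) $ j $ l)
        * (if x > 0 then Q $ k $ l else cnj (Q $ k $ l)))"
    unfolding Q_def by (auto simp: fun_eq_iff spectral_matrix_entry spectral_matrix_zero)
  also have "\<dots> \<in> borel_measurable borel"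
    by measurable
  finally show ?thesis .
qed

text \<open>The matrix power occurs twice, so the exponent doubles to 2b < 1. This is the threshold
  for integrability at 0 and, after division by x^2, at infinity.\<close>

lemma spectral_matrix_bound:
  fixes D :: "real^'n^'n"
  assumes "\<forall>z\<in>char_roots D. - 1/2 < Re z \<and> Re z < 1/2"
  obtains b K where "0 \<le> b" "b < 1/2" "0 \<le> K"
    "\<And>x i j. x \<noteq> 0 \<Longrightarrow> cmod (spectral_matrix D A x $ i $ j) \<le> K * exp (2 * b * \<bar>ln \<bar>x\<bar>\<bar>)"
proof -
  obtain b C where b: "0 \<le> b" "b < 1/2" "0 \<le> C" and C: "\<And>s i j. \<bar>mexp (s *\<^sub>R D) $ i $ j\<bar> \<le> C * exp (b * \<bar>s\<bar>)"
    using mexp_growth[of D "1/2"] assms by auto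
  define Q where "Q = A ** adjoint_mat A"
  define K where "K = (\<Sum>l\<in>UNIV. \<Sum>k\<in>UNIV. C * C * cmod (Q $ k $ l))"
  have "0 \<le> K"
    unfolding K_def using b by (intro sum_nonneg) simp
  moreover have "cmod (spectral_matrix D A x $ i $ j) \<le> K * exp (2 * b * \<bar>ln \<bar>x\<bar>\<bar>)" if "x \<noteq> 0" for x i j
  proof -
    define y where "y = - ln \<bar>x\<bar>"
    have "cmod (of_real (mexp (y *\<^sub>R D) $ i $ k * mexp (y *\<^sub>R D) $ j $ l) * (if x > 0 then Q $ k $ l else cnj (Q $ k $ l)))
        \<le> (C * exp (b * \<bar>y\<bar>)) * (C * exp (b * \<bar>y\<bar>)) * cmod (Q $ k $ l)" for k l
      unfolding norm_mult norm_of_real abs_mult using C[of y i k] C[of y j l] b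
      by (intro mult_mono mult_nonneg_nonneg) auto
    moreover have "(C * exp (b * \<bar>y\<bar>)) * (C * exp (b * \<bar>y\<bar>)) * q = C * C * q * exp (2 * b * \<bar>y\<bar>)" for q
      by (simp add: algebra_simps flip: exp_add)
    ultimately have "cmod (of_real (mexp (y *\<^sub>R D) $ i $ k * mexp (y *\<^sub>R D) $ j $ l) * (if x > 0 then Q $ k $ l else cnj (Q $ k $ l)))
        \<le> C * C * cmod (Q $ k $ l) * exp (2 * b * \<bar>y\<bar>)" for k l
      by simp
    then show ?thesis
      unfolding spectral_matrix_entry[OF that] y_def[symmetric] Q_def[symmetric] K_def sum_distrib_right
      by (intro order_trans[OF norm_sum] sum_mono order_trans[OF norm_sum]) (simp add: y_def)
  qed
  ultimately show ?thesis
    using b by (intro that[of b K]) auto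
qed

section \<open>Integrability of the covariance integrand\<close>

lemma ofbm_transfer_measurable [measurable]: "ofbm_transfer t \<in> borel_measurable borel"
  unfolding ofbm_transfer_def[abs_def] by measurable

text \<open>Stationarity of increments in spectral form. It yields the polarization identity and
  supplies the exponentials for Fourier uniqueness.\<close>

lemma ofbm_transfer_shift: "ofbm_transfer (u + v) x - ofbm_transfer u x = iexp (u * x) * ofbm_transfer v x"
  by (simp add: ofbm_transfer_def diff_divide_distrib[symmetric] distrib_right exp_add distrib_left right_diff_distrib)

text \<open>This bound is used for |x| <= 1, the next one for |x| > 1.\<close>

lemma ofbm_transfer_bound1: "cmod (ofbm_transfer t x) \<le> \<bar>t\<bar>"
proof (cases "x = 0")
  case False
  have "cmod (iexp (t * x) - 1) \<le> \<bar>t * x\<bar>"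
    using iexp_approx1[of "t * x" 0] by simp
  then show ?thesis
    using False by (simp add: ofbm_transfer_def norm_divide norm_mult field_simps abs_mult)
qed (simp add: ofbm_transfer_def)

lemma ofbm_transfer_bound2: "cmod (ofbm_transfer t x) \<le> 2 / \<bar>x\<bar>"
proof -
  have "cmod (iexp (t * x) - 1) \<le> 2"
    using norm_triangle_ineq4[of "iexp (t * x)" 1] by (simp only: norm_iexp) simp
  then show ?thesis
    by (simp add: ofbm_transfer_def norm_divide norm_mult divide_right_mono)
qed

text \<open>Carries gauge integrals of powers over to \<open>lborel\<close>: for nonnegative
  functions gauge integrability is absolute, and a Borel function may be moved from the completed
  measure.\<close>

lemma integrable_lborel_indicator_nonneg:
  fixes f :: "real \<Rightarrow> real"
  assumes "f integrable_on S" "S \<in> sets borel" "f \<in> borel_measurable borel" "\<And>x. x \<in> S \<Longrightarrow> 0 \<le> f x"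
  shows "integrable lborel (\<lambda>x. indicator S x * f x)"
proof -
  have "f absolutely_integrable_on S"
    using assms by (intro nonnegative_absolutely_integrable_1) auto
  then have "integrable lebesgue (\<lambda>x. indicator S x * f x)"
    by (simp add: set_integrable_def)
  moreover have "(\<lambda>x. indicator S x * f x) \<in> borel_measurable lborel"
    using assms by measurable
  ultimately show ?thesis
    by (simp add: integrable_completion)
qed

text \<open>Near 0 this is the growth of the spectral matrix alone; outside it is that growth times
  the decay x^(-2) of two transfer functions.\<close>

definition envelope :: "real \<Rightarrow> real \<Rightarrow> real" where
  "envelope b x = (if \<bar>x\<bar> \<le> 1 then \<bar>x\<bar> powr (- 2 * b) else \<bar>x\<bar> powr (2 * b - 2))"

lemma envelope_integrable:
  assumes "b < 1/2"
  shows "integrable lborel (envelope b)"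
proof -
  \<comment> \<open>One half-line suffices, the other being its reflection. The two pieces overlap
    at 1, so the sum only dominates the envelope.\<close>
  define g where "g x = indicator {0..1} x * x powr (- 2 * b) + indicator {1..} x * x powr (2 * b - 2)" for x :: real
  have "integrable lborel (\<lambda>x::real. indicator {0..1} x * x powr (- 2 * b))"
    using assms by (intro integrable_lborel_indicator_nonneg integrable_on_powr_from_0) auto
  moreover have "integrable lborel (\<lambda>x::real. indicator {1..} x * x powr (2 * b - 2))"
    using assms has_integral_powr_to_inf[of "2 * b - 2" 1]
    by (intro integrable_lborel_indicator_nonneg) (auto simp: integrable_on_def)
  ultimately have g: "integrable lborel g"
    unfolding g_def by (rule Bochner_Integration.integrable_add)
  have "integrable lborel (\<lambda>x. g (0 + (- 1) * x))"
    by (subst lborel_integrable_real_affine_iff) (use g in auto)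
  with g have "integrable lborel (\<lambda>x. g x + g (- x))"
    by simp
  then show ?thesis
  proof (rule Bochner_Integration.integrable_bound)
    show "AE x in lborel. norm (envelope b x) \<le> norm (g x + g (- x))"
    proof (intro AE_I2)
      fix x :: real
      have "envelope b x \<le> g x + g (- x)"
        by (auto simp: envelope_def g_def indicator_def)
      moreover have "0 \<le> envelope b x"
        by (simp add: envelope_def)
      ultimately show "norm (envelope b x) \<le> norm (g x + g (- x))"
        by simp
    qed
    show "envelope b \<in> borel_measurable lborel"
      unfolding envelope_def[abs_def] by measurable
  qed
qed

lemma ofbm_integrand_integrable:
  fixes D :: "real^'n^'n"
  assumes "\<forall>z\<in>char_roots D. - 1/2 < Re z \<and> Re z < 1/2"
  shows "integrable lborel (\<lambda>x. ofbm_transfer t x * cnj (ofbm_transfer s x) * spectral_matrix D A x $ i $ j)"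
proof -
  obtain b K where b: "0 \<le> b" "b < 1/2" "0 \<le> K"
    and K: "\<And>x i j. x \<noteq> 0 \<Longrightarrow> cmod (spectral_matrix D A x $ i $ j) \<le> K * exp (2 * b * \<bar>ln \<bar>x\<bar>\<bar>)"
    using spectral_matrix_bound[OF assms] by metis
  \<comment> \<open>|t||s| comes from the bound for |x| <= 1, and 4 = 2 * 2 from the one for |x| >
    1.\<close>
  define B where "B = \<bar>t\<bar> * \<bar>s\<bar> + 4"
  show ?thesis
  proof (rule Bochner_Integration.integrable_bound)
    show "integrable lborel (\<lambda>x. B * K * envelope b x)"
      using envelope_integrable[OF b(2)] by simp
    have [measurable]: "cnj \<in> borel_measurable borel"
      by (intro borel_measurable_continuous_onI continuous_intros)
    show "(\<lambda>x. ofbm_transfer t x * cnj (ofbm_transfer s x) * spectral_matrix D A x $ i $ j) \<in> borel_measurable lborel"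
      by measurable
    show "AE x in lborel. norm (ofbm_transfer t x * cnj (ofbm_transfer s x) * spectral_matrix D A x $ i $ j)
        \<le> norm (B * K * envelope b x)"
    proof (intro AE_I2)
      fix x :: real
      have "B \<ge> 0" by (simp add: B_def)
      consider "x = 0" | "x \<noteq> 0" "\<bar>x\<bar> \<le> 1" | "\<bar>x\<bar> > 1" by linarith
      then show "norm (ofbm_transfer t x * cnj (ofbm_transfer s x) * spectral_matrix D A x $ i $ j)
          \<le> norm (B * K * envelope b x)"
      proof cases
        case 1
        then show ?thesis by (simp add: spectral_matrix_zero)
      next
        case 2
        have "cmod (ofbm_transfer t x) * cmod (ofbm_transfer s x) \<le> \<bar>t\<bar> * \<bar>s\<bar>"
          by (intro mult_mono ofbm_transfer_bound1) auto
        then have "cmod (ofbm_transfer t x) * cmod (ofbm_transfer s x) \<le> B"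
          by (simp add: B_def)
        moreover have "exp (2 * b * \<bar>ln \<bar>x\<bar>\<bar>) = envelope b x"
          using 2 by (simp add: envelope_def powr_def)
        ultimately show ?thesis
          using mult_mono[OF _ K[OF 2(1), of i j], of "cmod (ofbm_transfer t x) * cmod (ofbm_transfer s x)" B] b \<open>B \<ge> 0\<close>
          by (simp add: norm_mult abs_mult envelope_def mult.assoc)
      next
        case 3
        then have x: "x \<noteq> 0" by auto
        have "cmod (ofbm_transfer t x) * cmod (ofbm_transfer s x) \<le> (2 / \<bar>x\<bar>) * (2 / \<bar>x\<bar>)"
          by (intro mult_mono ofbm_transfer_bound2) auto
        also have "\<dots> \<le> B * \<bar>x\<bar> powr (- 2)"
          using 3
          by (simp add: B_def powr_minus field_simps power2_eq_square) (intro divide_right_mono, auto)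
        finally have "cmod (ofbm_transfer t x) * cmod (ofbm_transfer s x) \<le> B * \<bar>x\<bar> powr (- 2)" .
        moreover have "exp (2 * b * \<bar>ln \<bar>x\<bar>\<bar>) * \<bar>x\<bar> powr (- 2) = envelope b x"
          using 3 by (simp add: envelope_def powr_def flip: exp_add) (simp add: algebra_simps)
        moreover have "cmod (spectral_matrix D A x $ i $ j) \<le> K * exp (2 * b * \<bar>ln \<bar>x\<bar>\<bar>)"
          by (rule K[OF x])
        ultimately have "cmod (ofbm_transfer t x) * cmod (ofbm_transfer s x) * cmod (spectral_matrix D A x $ i $ j)
            \<le> (B * \<bar>x\<bar> powr (- 2)) * (K * exp (2 * b * \<bar>ln \<bar>x\<bar>\<bar>))"
          using \<open>B \<ge> 0\<close> by (intro mult_mono[where c = "cmod (spectral_matrix D A x $ i $ j)"]) auto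
        also have "\<dots> = B * K * envelope b x"
          unfolding \<open>exp (2 * b * \<bar>ln \<bar>x\<bar>\<bar>) * \<bar>x\<bar> powr (- 2) = envelope b x\<close>[symmetric] by (simp add: ac_simps)
        finally show ?thesis
          by (simp add: norm_mult)
      qed
    qed
  qed
qed

section \<open>Square roots of positive definite matrices\<close>

text \<open>After rescaling, \<open>R = 1 - Z\<close> with \<open>norm Z < 1\<close>, and a square root is \<open>1 - Y\<close> for the fixed point \<open>Y\<close> of the
  contraction \<open>Y \<mapsto> (Z + Y\<^sup>2) / 2\<close>.\<close>

lemma blinfun_sqrt_contraction:
  fixes Z :: "'a::euclidean_space \<Rightarrow>\<^sub>L 'a"
  assumes Z: "norm Z \<le> q" "q < 1" and sym: "\<And>x y. Z x \<bullet> y = x \<bullet> Z y"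
  obtains Y :: "'a \<Rightarrow>\<^sub>L 'a" where "norm Y \<le> q" "\<And>x y. Y x \<bullet> y = x \<bullet> Y y" "Y = (1/2) *\<^sub>R (Z + (Y o\<^sub>L Y))"
proof -
  \<comment> \<open>Symmetry is a closed condition, so building it into the domain makes the fixed
    point symmetric. The ball is preserved because q + q^2 <= 2q.\<close>
  define S where "S = cball 0 q \<inter> (\<Inter>x. \<Inter>y. {Y :: 'a \<Rightarrow>\<^sub>L 'a. Y x \<bullet> y = x \<bullet> Y y})"
  define f where "f Y = (1/2) *\<^sub>R (Z + (Y o\<^sub>L Y))" for Y :: "'a \<Rightarrow>\<^sub>L 'a"
  have q: "0 \<le> q"
    using Z norm_ge_zero order_trans by blast
  have "closed S"
    unfolding S_def by (intro closed_Int closed_INT ballI closed_cball closed_Collect_eq continuous_intros)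
  have bound: "norm (Y o\<^sub>L W) \<le> norm Y * norm W" for Y W :: "'a \<Rightarrow>\<^sub>L 'a"
    by (rule norm_blinfun_compose)
  have "f ` S \<subseteq> S"
  proof
    fix X assume "X \<in> f ` S"
    then obtain Y :: "'a \<Rightarrow>\<^sub>L 'a" where X: "X = f Y" and Y: "norm Y \<le> q" "\<And>x y. Y x \<bullet> y = x \<bullet> Y y"
      by (auto simp: S_def)
    have "norm (Z + (Y o\<^sub>L Y)) \<le> q + q * q"
      using Z Y bound[of Y Y] mult_mono[OF Y(1) Y(1) q] by (intro norm_triangle_mono) auto
    also have "\<dots> \<le> 2 * q"
      using q Z by (simp add: mult_left_le_one_le)
    finally have "norm X \<le> q"
      by (simp add: X f_def)
    moreover have "X x \<bullet> y = x \<bullet> X y" for x y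
      by (simp add: X f_def blinfun.bilinear_simps inner_add_left inner_add_right sym Y(2))
    ultimately show "X \<in> S"
      by (simp add: S_def)
  qed
  moreover have "dist (f Y) (f W) \<le> q * dist Y W" if "Y \<in> S" "W \<in> S" for Y W
  proof -
    \<comment> \<open>Y^2 - W^2 = Y (Y - W) + (Y - W) W holds without commutativity, and with norms
      at most q it gives Lipschitz constant q.\<close>
    have "f Y - f W = (1/2) *\<^sub>R ((Y o\<^sub>L (Y - W)) + ((Y - W) o\<^sub>L W))"
      by (rule blinfun_eqI) (simp add: f_def blinfun.bilinear_simps algebra_simps)
    then have "norm (f Y - f W) \<le> (norm Y * norm (Y - W) + norm (Y - W) * norm W) / 2"
      using norm_triangle_mono[OF bound[of Y "Y - W"] bound[of "Y - W" W]] by simp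
    also have "\<dots> \<le> (q * norm (Y - W) + norm (Y - W) * q) / 2"
      using that by (intro divide_right_mono add_mono mult_right_mono mult_left_mono) (auto simp: S_def)
    finally show ?thesis
      by (simp add: dist_norm mult.commute)
  qed
  moreover have "0 \<in> S"
    using q by (simp add: S_def)
  ultimately obtain Y where "Y \<in> S" "f Y = Y"
    using Banach_fix[OF complete_eq_closed[THEN iffD2, OF \<open>closed S\<close>] _ q \<open>q < 1\<close>] by blast
  then show ?thesis
    by (intro that[of Y]) (auto simp: S_def f_def)
qed

text \<open>For a symmetric operator the quadratic form controls the norm. Polarize at x and at y,
  which is Z x rescaled to the length of x; positivity allows dropping the term in x - y.\<close>

lemma symmetric_blinfun_norm_le:
  fixes Z :: "'a::euclidean_space \<Rightarrow>\<^sub>L 'a"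
  assumes sym: "\<And>x y. Z x \<bullet> y = x \<bullet> Z y" and pos: "\<And>x. 0 \<le> x \<bullet> Z x"
    and le: "\<And>x. x \<bullet> Z x \<le> q * (norm x)\<^sup>2" and q: "0 \<le> q"
  shows "norm Z \<le> q"
proof (rule norm_blinfun_bound[OF q])
  fix x
  show "norm (Z x) \<le> q * norm x"
  proof (cases "x = 0 \<or> Z x = 0")
    case False
    define y where "y = (norm x / norm (Z x)) *\<^sub>R Z x"
    have y: "norm y = norm x" "Z x \<bullet> y = norm x * norm (Z x)"
      using False by (simp_all add: y_def dot_square_norm power2_eq_square)
    have "4 * (Z x \<bullet> y) = (x + y) \<bullet> Z (x + y) - (x - y) \<bullet> Z (x - y)"
      using sym[of x y] by (simp add: blinfun.bilinear_simps inner_add_left inner_add_right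
          inner_diff_left inner_diff_right inner_commute)
    also have "\<dots> \<le> q * (norm (x + y))\<^sup>2"
      using le[of "x + y"] pos[of "x - y"] by simp
    also have "\<dots> \<le> q * (2 * norm x)\<^sup>2"
      using norm_triangle_ineq[of x y] y q by (intro mult_left_mono power_mono) auto
    finally have "norm x * norm (Z x) \<le> norm x * (q * norm x)"
      by (simp add: y power2_eq_square mult.left_commute)
    then show ?thesis
      using False by simp
  qed (use q in auto)
qed

lemma transpose_eq_iff_inner: "transpose R = R \<longleftrightarrow> (\<forall>x y. (R *v x) \<bullet> y = x \<bullet> (R *v y))"
  for R :: "real^'n^'n"
proof
  assume "transpose R = R"
  then show "\<forall>x y. (R *v x) \<bullet> y = x \<bullet> (R *v y)"
    by (metis dot_lmul_matrix transpose_matrix_vector)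
next
  assume *: "\<forall>x y. (R *v x) \<bullet> y = x \<bullet> (R *v y)"
  show "transpose R = R"
    using *[rule_format, of "axis _ 1" "axis _ 1"]
    by (simp add: vec_eq_iff transpose_def matrix_vector_mult_basis column_def inner_axis inner_axis')
qed

lemma pos_def_sqrt:
  fixes R :: "real^'n^'n"
  assumes "pos_def R"
  obtains W where "pos_def W" "W ** W = R"
proof -
  have symR: "(R *v x) \<bullet> y = x \<bullet> (R *v y)" for x y
    using assms transpose_eq_iff_inner by (auto simp: pos_def_def)
  have posR: "x \<noteq> 0 \<Longrightarrow> 0 < x \<bullet> (R *v x)" for x
    using assms by (simp add: pos_def_def)
  have cont: "continuous_on (sphere 0 1) (\<lambda>x. x \<bullet> (R *v x))"
    by (intro continuous_intros matrix_vector_mult_linear_continuous_on)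
  obtain u where u: "norm u = 1" "\<And>x. norm x = 1 \<Longrightarrow> u \<bullet> (R *v u) \<le> x \<bullet> (R *v x)"
    using continuous_attains_inf[OF _ _ cont] by auto
  obtain v where v: "norm v = 1" "\<And>x. norm x = 1 \<Longrightarrow> x \<bullet> (R *v x) \<le> v \<bullet> (R *v v)"
    using continuous_attains_sup[OF _ _ cont] by auto
  \<comment> \<open>m and c are the extreme values of the quadratic form on the unit sphere.
    Dividing R by c makes Z = 1 - R/c nonnegative, and m > 0 gives norm at most 1 - m/c < 1.\<close>
  define m where "m = u \<bullet> (R *v u)"
  define c where "c = v \<bullet> (R *v v)"
  have m: "0 < m" "m \<le> c"
    using posR[of u] u(1) u(2)[OF v(1)] by (force simp: m_def c_def)+
  have R_bounds: "m * (norm x)\<^sup>2 \<le> x \<bullet> (R *v x)" "x \<bullet> (R *v x) \<le> c * (norm x)\<^sup>2" for x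
  proof -
    have "m * (norm x)\<^sup>2 \<le> x \<bullet> (R *v x) \<and> x \<bullet> (R *v x) \<le> c * (norm x)\<^sup>2"
    proof (cases "x = 0")
      case False
      define z where "z = x /\<^sub>R norm x"
      have "norm z = 1" and x: "x = norm x *\<^sub>R z"
        using False by (simp_all add: z_def)
      have "x \<bullet> (R *v x) = (norm x)\<^sup>2 * (z \<bullet> (R *v z))"
        by (subst (1 2) x) (simp add: matrix_vector_mult_scaleR power2_eq_square)
      then show ?thesis
        using u(2)[OF \<open>norm z = 1\<close>] v(2)[OF \<open>norm z = 1\<close>] by (simp add: m_def c_def mult.commute mult_right_mono)
    qed simp
    then show "m * (norm x)\<^sup>2 \<le> x \<bullet> (R *v x)" "x \<bullet> (R *v x) \<le> c * (norm x)\<^sup>2"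
      by auto
  qed
  define Z where "Z = Blinfun (\<lambda>x. x - (1/c) *\<^sub>R (R *v x))"
  have Z: "Z x = x - (1/c) *\<^sub>R (R *v x)" for x
    unfolding Z_def
    by (subst bounded_linear_Blinfun_apply)
      (intro bounded_linear_sub bounded_linear_ident bounded_linear_const_scaleR matrix_vector_mul_bounded_linear, simp)
  define q where "q = 1 - m / c"
  have q: "0 \<le> q" "q < 1"
    using m by (auto simp: q_def)
  have symZ: "Z x \<bullet> y = x \<bullet> Z y" for x y
    by (simp add: Z inner_diff_left inner_diff_right symR)
  have "norm Z \<le> q"
  proof (rule symmetric_blinfun_norm_le[OF symZ _ _ q(1)])
    fix x
    show "0 \<le> x \<bullet> Z x" "x \<bullet> Z x \<le> q * (norm x)\<^sup>2"
      using R_bounds[of x] m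
      by (auto simp: Z q_def inner_diff_right dot_square_norm field_simps)
  qed
  then obtain Y :: "(real^'n) \<Rightarrow>\<^sub>L (real^'n)" where Y: "norm Y \<le> q" "\<And>x y. Y x \<bullet> y = x \<bullet> Y y" "Y = (1/2) *\<^sub>R (Z + (Y o\<^sub>L Y))"
    using blinfun_sqrt_contraction[OF _ q(2) symZ] by metis
  \<comment> \<open>By the fixed point equation (1 - Y)^2 = 1 - Z = R/c, whence the factor
    \<open>sqrt c\<close>. Positivity of W follows from norm Y < 1.\<close>
  define W where "W = matrix (\<lambda>x. sqrt c *\<^sub>R (x - Y x))"
  have W: "W *v x = sqrt c *\<^sub>R (x - Y x)" for x
  proof -
    have "bounded_linear (\<lambda>x. sqrt c *\<^sub>R (x - Y x))"
      by (intro bounded_linear_const_scaleR bounded_linear_sub bounded_linear_ident blinfun.bounded_linear_right)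
    then show ?thesis
      unfolding W_def by (simp add: matrix_vector_mul(3)[THEN fun_cong])
  qed
  have "transpose W = W"
    unfolding transpose_eq_iff_inner by (simp add: W inner_diff_left inner_diff_right Y(2))
  moreover have "0 < x \<bullet> (W *v x)" if "x \<noteq> 0" for x
  proof -
    have "x \<bullet> Y x \<le> norm x * (norm Y * norm x)"
      using norm_cauchy_schwarz[of x "Y x"] norm_blinfun[of Y x] by (meson mult_left_mono norm_ge_zero order_trans)
    also have "\<dots> \<le> norm x * (q * norm x)"
      using Y(1) by (intro mult_left_mono mult_right_mono) auto
    also have "\<dots> < norm x * norm x"
      using that q by simp
    finally show ?thesis
      using m by (simp add: W inner_diff_right dot_square_norm power2_eq_square)
  qed
  moreover have "W ** W = R"
  proof -
    have "W *v (W *v x) = R *v x" for x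
    proof -
      have "2 *\<^sub>R Y x = Z x + Y (Y x)"
        using arg_cong[OF Y(3), of "\<lambda>B. 2 *\<^sub>R B x"] by (simp add: blinfun.bilinear_simps)
      then have "x - Y x - Y x + Y (Y x) = (1/c) *\<^sub>R (R *v x)"
        by (simp add: Z scaleR_2 algebra_simps)
      moreover have "W *v (W *v x) = c *\<^sub>R (x - Y x - Y x + Y (Y x))"
        using m by (simp add: W blinfun.bilinear_simps algebra_simps flip: scaleR_diff_right)
      ultimately show ?thesis
        using m by simp
    qed
    then show ?thesis
      by (simp add: matrix_eq matrix_vector_mul_assoc)
  qed
  ultimately show ?thesis
    by (intro that[of W]) (auto simp: pos_def_def)
qed

section \<open>Covariance integrals of fractional Brownian motion\<close>

lemma not_AE_notin_interval:
  assumes "a < (b :: real)"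
  shows "\<not> (AE x in lborel. x \<notin> {a<..<b})"
proof
  assume "AE x in lborel. x \<notin> {a<..<b}"
  then have "{a<..<b} \<in> null_sets lborel"
    by (subst (asm) AE_iff_null_sets[symmetric]) auto
  then show False
    using assms by (simp add: null_sets_def)
qed

text \<open>A nonzero value would persist on a ball, which has positive measure.\<close>

lemma AE_zero_continuous_imp_zero:
  fixes f :: "real \<Rightarrow> real"
  assumes cont: "continuous_on {a<..<b} f" and ae: "AE x in lborel. x \<in> {a<..<b} \<longrightarrow> f x = 0"
    and x: "x \<in> {a<..<b}"
  shows "f x = 0"
proof (rule ccontr)
  assume nz: "f x \<noteq> 0"
  have "open ({a<..<b} \<inter> f -` (- {0}))"
    using cont by (intro continuous_open_preimage) auto
  moreover have "x \<in> {a<..<b} \<inter> f -` (- {0})"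
    using x nz by simp
  ultimately obtain e where e: "e > 0" "ball x e \<subseteq> {a<..<b} \<inter> f -` (- {0})"
    using open_contains_ball by blast
  have "AE y in lborel. y \<notin> {x - e<..<x + e}"
    using ae
  proof eventually_elim
    case (elim y)
    then show ?case
      using e(2) by (auto simp: ball_eq_greaterThanLessThan subset_iff)
  qed
  then show False
    using not_AE_notin_interval[of "x - e" "x + e"] e by simp
qed

lemma ofbm_transfer_zero [simp]: "ofbm_transfer t 0 = 0" "ofbm_transfer 0 x = 0"
  by (simp_all add: ofbm_transfer_def)

lemma ofbm_transfer_1_nonzero:
  assumes "0 < x" "x < pi"
  shows "ofbm_transfer 1 x \<noteq> 0"
proof
  assume "ofbm_transfer 1 x = 0"
  then have "exp (\<i> * of_real x) = 1"
    using assms by (simp add: ofbm_transfer_def)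
  then have "Im (exp (\<i> * of_real x)) = 0"
    by simp
  then show False
    using sin_gt_zero[OF assms] by (simp add: Im_exp)
qed

text \<open>By stationarity the difference of the transfer functions at t and s has the modulus of
  the one at t - s. This is the origin of the three-term covariance.\<close>

lemma ofbm_transfer_polarization:
  "2 * Re (ofbm_transfer t x * cnj (ofbm_transfer s x))
    = (cmod (ofbm_transfer t x))\<^sup>2 + (cmod (ofbm_transfer s x))\<^sup>2 - (cmod (ofbm_transfer (t - s) x))\<^sup>2"
proof -
  have *: "2 * Re (a * cnj b) = (cmod a)\<^sup>2 + (cmod b)\<^sup>2 - (cmod (a - b))\<^sup>2" for a b
    unfolding cmod_power2 by (simp add: power2_diff)
  have eq: "cmod (ofbm_transfer t x - ofbm_transfer s x) = cmod (ofbm_transfer (t - s) x)"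
    using arg_cong[OF ofbm_transfer_shift[of s "t - s" x], of cmod] unfolding norm_mult norm_iexp by simp
  show ?thesis
    unfolding * eq ..
qed

text \<open>Variance at time t for the scalar spectral density |x|^(-2d). Its value at t = 1 becomes
  the constant c of the fractional Brownian motion.\<close>

definition fbm_density_integral :: "real \<Rightarrow> real \<Rightarrow> real" where
  "fbm_density_integral d t = (LBINT x. (cmod (ofbm_transfer t x))\<^sup>2 * \<bar>x\<bar> powr (- 2 * d))"

lemma ofbm_transfer_rescale:
  assumes "t \<noteq> 0"
  shows "ofbm_transfer t (x / t) = of_real t * ofbm_transfer 1 x"
  using assms by (cases "x = 0") (simp_all add: ofbm_transfer_def field_simps)

text \<open>Self-similarity: substituting x/t gives t^2 from the transfer function, |t|^(2d) from
  the density and 1/|t| from dx.\<close>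

lemma fbm_density_integral_scale:
  "fbm_density_integral d t = \<bar>t\<bar> powr (2 * d + 1) * fbm_density_integral d 1"
proof (cases "t = 0")
  case False
  define f where "f x = (cmod (ofbm_transfer t x))\<^sup>2 * \<bar>x\<bar> powr (- 2 * d)" for x
  have "fbm_density_integral d t = \<bar>1 / t\<bar> *\<^sub>R (LBINT x. f (0 + (1 / t) * x))"
    unfolding fbm_density_integral_def f_def[symmetric]
    using False by (intro lborel_integral_real_affine) simp
  also have "f (0 + (1 / t) * x) = (\<bar>t\<bar>\<^sup>2 * \<bar>t\<bar> powr (2 * d)) * ((cmod (ofbm_transfer 1 x))\<^sup>2 * \<bar>x\<bar> powr (- 2 * d))" for x
    using False ofbm_transfer_rescale[OF False, of x]
    by (simp add: f_def norm_mult power_mult_distrib abs_divide powr_divide powr_minus field_simps)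
  then have "(LBINT x. f (0 + (1 / t) * x)) = (\<bar>t\<bar>\<^sup>2 * \<bar>t\<bar> powr (2 * d)) * fbm_density_integral d 1"
    by (simp add: fbm_density_integral_def)
  also have "\<bar>1 / t\<bar> *\<^sub>R \<dots> = \<bar>t\<bar> powr (2 * d + 1) * fbm_density_integral d 1"
    using False by (cases "t > 0") (simp_all add: powr_add power2_eq_square)
  finally show ?thesis .
qed (simp add: fbm_density_integral_def)

lemma fbm_density_integral_pos:
  assumes int: "integrable lborel (\<lambda>x. (cmod (ofbm_transfer 1 x))\<^sup>2 * \<bar>x\<bar> powr (- 2 * d))"
  shows "0 < fbm_density_integral d 1"
proof -
  have "fbm_density_integral d 1 \<noteq> 0"
  proof
    assume "fbm_density_integral d 1 = 0"
    then have "AE x in lborel. (cmod (ofbm_transfer 1 x))\<^sup>2 * \<bar>x\<bar> powr (- 2 * d) = 0"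
      unfolding fbm_density_integral_def
      by (subst (asm) integral_nonneg_eq_0_iff_AE[OF int]) auto
    then have "AE x in lborel. x \<notin> {0<..<1 :: real}"
    proof eventually_elim
      case (elim x)
      then show ?case
        using ofbm_transfer_1_nonzero[of x] pi_gt3 by auto
    qed
    then show False
      using not_AE_notin_interval[of 0 1] by simp
  qed
  moreover have "0 \<le> fbm_density_integral d 1"
    unfolding fbm_density_integral_def by (intro Bochner_Integration.integral_nonneg) simp
  ultimately show ?thesis by simp
qed

lemma fbm_cov_integral:
  assumes int: "\<And>t. integrable lborel (\<lambda>x. (cmod (ofbm_transfer t x))\<^sup>2 * \<bar>x\<bar> powr (- 2 * d))"
  shows "(LBINT x. Re (ofbm_transfer t x * cnj (ofbm_transfer s x)) * \<bar>x\<bar> powr (- 2 * d))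
    = fbm_density_integral d 1 / 2
      * (\<bar>t\<bar> powr (2 * (d + 1/2)) + \<bar>s\<bar> powr (2 * (d + 1/2)) - \<bar>t - s\<bar> powr (2 * (d + 1/2)))"
proof -
  have *: "Re (ofbm_transfer t x * cnj (ofbm_transfer s x)) * p = (1/2) *
      ((cmod (ofbm_transfer t x))\<^sup>2 * p + (cmod (ofbm_transfer s x))\<^sup>2 * p - (cmod (ofbm_transfer (t - s) x))\<^sup>2 * p)" for x p
    unfolding left_diff_distrib[symmetric] distrib_right[symmetric] ofbm_transfer_polarization[symmetric] by simp
  have "(LBINT x. Re (ofbm_transfer t x * cnj (ofbm_transfer s x)) * \<bar>x\<bar> powr (- 2 * d))
    = (1/2) * (fbm_density_integral d t + fbm_density_integral d s - fbm_density_integral d (t - s))"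
    using int unfolding * fbm_density_integral_def by simp
  then show ?thesis
    by (simp add: fbm_density_integral_scale[of d t] fbm_density_integral_scale[of d s]
        fbm_density_integral_scale[of d "t - s"] algebra_simps)
qed

lemma congruence_entry:
  "(X ** R ** transpose Y) $ i $ j = (\<Sum>l\<in>UNIV. \<Sum>k\<in>UNIV. X $ i $ k * Y $ j $ l * R $ k $ l)"
  for R :: "real^'n^'n"
  by (simp add: matrix_matrix_mult_def transpose_def sum_distrib_right sum_distrib_left ac_simps)

lemma matrix_add_rdistrib: "(A + B) ** C = A ** C + B ** (C :: real^'m^'n)" for A B :: "real^'n^'l"
  by (simp add: matrix_matrix_mult_def vec_eq_iff sum.distrib distrib_right)

text \<open>The congruences form the flow of the Lyapunov operator R -> D R + R D^T. Differentiating
  with D on the right of the exponential puts D next to R.\<close>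

lemma mexp_congruence_has_derivative:
  fixes D R :: "real^'n^'n"
  defines "F \<equiv> \<lambda>R s. mexp (s *\<^sub>R D) ** R ** transpose (mexp (s *\<^sub>R D))"
  shows "((\<lambda>s. F R s $ i $ j) has_real_derivative F (D ** R + R ** transpose D) s $ i $ j) (at s)"
proof -
  let ?E = "mexp (s *\<^sub>R D)"
  have "F (D ** R + R ** transpose D) s $ i $ j
      = ((?E ** D) ** R ** transpose ?E) $ i $ j + (?E ** R ** transpose (?E ** D)) $ i $ j"
    unfolding F_def matrix_transpose_mul
    by (simp add: matrix_add_ldistrib matrix_add_rdistrib matrix_mul_assoc flip: vector_add_component)
  also have "\<dots> = (\<Sum>l\<in>UNIV. \<Sum>k\<in>UNIV. (?E ** D) $ i $ k * ?E $ j $ l * R $ k $ l + ?E $ i $ k * (?E ** D) $ j $ l * R $ k $ l)"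
    unfolding congruence_entry by (simp add: sum.distrib)
  finally show ?thesis
    unfolding F_def congruence_entry[of "mexp (_ *\<^sub>R D)" R]
    by (auto intro!: derivative_eq_intros mexp_has_derivative_right simp: algebra_simps)
qed

text \<open>R is an eigenvector of the Lyapunov operator with eigenvalue 2d, so each entry of the
  flow, multiplied by exp(-2ds), has derivative 0.\<close>

lemma mexp_congruence_eq:
  fixes D R :: "real^'n^'n"
  assumes "D ** R + R ** transpose D = (2 * d) *\<^sub>R R"
  shows "mexp (s *\<^sub>R D) ** R ** transpose (mexp (s *\<^sub>R D)) = exp (2 * d * s) *\<^sub>R R"
proof -
  define F where "F R s = mexp (s *\<^sub>R D) ** R ** transpose (mexp (s *\<^sub>R D))" for R s
  have lin: "F ((2 * d) *\<^sub>R R) s = (2 * d) *\<^sub>R F R s" for s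
    by (simp add: F_def scaleR_matrix_mult matrix_mult_scaleR)
  have "exp (- 2 * d * s) * F R s $ i $ j = R $ i $ j" for i j
  proof -
    have "((\<lambda>s. exp (- 2 * d * s) * F R s $ i $ j) has_real_derivative 0) (at s)" for s
      using mexp_congruence_has_derivative[of D R i j s, folded F_def] lin[of s]
      unfolding assms by (auto intro!: derivative_eq_intros simp: algebra_simps)
    then have "exp (- 2 * d * s) * F R s $ i $ j = exp (- 2 * d * 0) * F R 0 $ i $ j"
      using DERIV_isconst_all[of "\<lambda>s. exp (- 2 * d * s) * F R s $ i $ j"] by blast
    then show ?thesis
      by (simp add: F_def mexp_zero del: scale_zero_left)
  qed
  then have "F R s $ i $ j = exp (2 * d * s) * R $ i $ j" for i j
    by (simp add: exp_minus field_simps flip: exp_add)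
  then show ?thesis
    by (simp add: F_def vec_eq_iff)
qed

lemma spectral_matrix_Re_Im:
  fixes D :: "real^'n^'n" and A :: "complex^'n^'n"
  assumes "x > 0"
  defines "E \<equiv> mexp ((- ln x) *\<^sub>R D)" and "Q \<equiv> A ** adjoint_mat A"
  shows "Re (spectral_matrix D A x $ i $ j) = (E ** mRe Q ** transpose E) $ i $ j"
    and "Im (spectral_matrix D A x $ i $ j) = (E ** mIm Q ** transpose E) $ i $ j"
  using assms(1) spectral_matrix_entry[of x D A i j]
  unfolding congruence_entry E_def Q_def by (simp_all add: mRe_def mIm_def)

section \<open>Stabilizers of positive definite forms\<close>

lemma matrix_inv_works:
  assumes "invertible A"
  shows "A ** matrix_inv A = mat 1" "matrix_inv A ** A = mat 1"
  using someI_ex[OF assms[unfolded invertible_def]] by (simp_all add: matrix_inv_def)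

lemma pos_def_invertible:
  fixes W :: "real^'n^'n"
  assumes "pos_def W"
  shows "invertible W"
proof -
  have "x = 0" if "W *v x = 0" for x
    using assms that unfolding pos_def_def by (metis inner_zero_right less_irrefl)
  then show ?thesis
    using matrix_left_invertible_ker[of W] invertible_left_inverse[of W] by blast
qed

lemma pos_def_diag: "pos_def P \<Longrightarrow> 0 < P $ k $ k"
  unfolding pos_def_def
  by (metis (no_types) axis_eq_0_iff cart_eq_inner_axis column_def inner_commute matrix_vector_mult_basis
      vec_lambda_beta zero_neq_one)

lemma pos_def_inverse:
  fixes W :: "real^'n^'n"
  assumes "pos_def W"
  defines "V \<equiv> matrix_inv W"
  shows "W ** V = mat 1" "V ** W = mat 1" "transpose V = V"
proof -
  show WV: "W ** V = mat 1" and VW: "V ** W = mat 1"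
    unfolding V_def using matrix_inv_works[OF pos_def_invertible[OF assms(1)]] by auto
  have "W ** transpose V = mat 1"
    using arg_cong[OF VW, of transpose] assms(1) by (simp add: matrix_transpose_mul pos_def_def transpose_mat)
  then have "V ** (W ** transpose V) = V"
    by simp
  then show "transpose V = V"
    by (simp add: matrix_mul_assoc VW)
qed

lemma pos_def_square:
  fixes W :: "real^'n^'n"
  assumes "pos_def W"
  shows "pos_def (W ** W)"
  unfolding pos_def_def
proof (intro conjI allI impI)
  have W: "transpose W = W"
    using assms by (simp add: pos_def_def)
  then show "transpose (W ** W) = W ** W"
    by (simp add: matrix_transpose_mul)
  fix x :: "real^'n" assume "x \<noteq> 0"
  then have "W *v x \<noteq> 0"
    using assms unfolding pos_def_def by (metis inner_zero_right less_irrefl)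
  moreover have "x \<bullet> ((W ** W) *v x) = (W *v x) \<bullet> (W *v x)"
    using W transpose_eq_iff_inner[of W] by (simp add: matrix_vector_mul_assoc[symmetric])
  ultimately show "0 < x \<bullet> ((W ** W) *v x)"
    by simp
qed

text \<open>In the coordinates given by W the form W^2 becomes the identity, and its stabilizer
  becomes the orthogonal group.\<close>

lemma congruence_stabilizer_eq:
  fixes W :: "real^'n^'n"
  assumes "pos_def W"
  shows "{C. invertible C \<and> C ** (W ** W) ** transpose C = W ** W}
    = {W ** U ** matrix_inv W | U. orthogonal_matrix U}"
proof -
  define V where "V = matrix_inv W"
  have WV: "W ** V = mat 1" "V ** W = mat 1" "transpose V = V" "transpose W = W"
    using pos_def_inverse[OF assms] assms by (auto simp: V_def pos_def_def)
  have WVX: "W ** (V ** X) = X" "V ** (W ** X) = X" for X :: "real^'n^'n"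
    by (simp_all add: matrix_mul_assoc WV)
  have "\<exists>U. C = W ** U ** V \<and> orthogonal_matrix U" if "C ** (W ** W) ** transpose C = W ** W" for C
  proof (intro exI conjI)
    define U where "U = V ** C ** W"
    show "C = W ** U ** V"
      by (simp add: U_def WV WVX matrix_mul_assoc[symmetric])
    have "U ** transpose U = V ** (C ** (W ** W) ** transpose C) ** V"
      by (simp add: U_def matrix_transpose_mul WV matrix_mul_assoc)
    also have "\<dots> = mat 1"
      unfolding that by (simp add: WV WVX matrix_mul_assoc[symmetric])
    finally show "orthogonal_matrix U"
      using matrix_left_right_inverse by (auto simp: orthogonal_matrix_def)
  qed
  moreover have "invertible (W ** U ** V) \<and> (W ** U ** V) ** (W ** W) ** transpose (W ** U ** V) = W ** W"
    if "orthogonal_matrix U" for U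
  proof
    have UU: "U ** transpose U = mat 1"
      using that by (simp add: orthogonal_matrix_def)
    then have UUX: "U ** (transpose U ** X) = X" for X :: "real^'n^'n"
      by (simp add: matrix_mul_assoc)
    have "invertible W" "invertible V" "invertible U"
      using WV that by (auto simp: invertible_def orthogonal_matrix_def)
    then show "invertible (W ** U ** V)"
      by (intro invertible_mult)
    show "(W ** U ** V) ** (W ** W) ** transpose (W ** U ** V) = W ** W"
      by (simp add: matrix_transpose_mul WV WVX UUX matrix_mul_assoc[symmetric])
  qed
  ultimately show ?thesis
    unfolding V_def[symmetric] by blast
qed

text \<open>Changing the sign of one coordinate kills the off-diagonal entries; swapping two
  coordinates equates the diagonal ones.\<close>

lemma orthogonal_invariant_scalar:
  fixes G :: "real^'n^'n"
  assumes "\<And>U. orthogonal_matrix U \<Longrightarrow> U ** G ** transpose U = G"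
  obtains g where "G = g *\<^sub>R mat 1"
proof -
  have off: "G $ i $ j = 0" if "i \<noteq> j" for i j
  proof -
    define U :: "real^'n^'n" where "U = (\<chi> a b. if a = b then (if a = i then - 1 else 1) else 0)"
    have UX: "(U ** X) $ a $ b = (if a = i then - 1 else 1) * X $ a $ b" for X :: "real^'n^'n" and a b
      by (simp add: U_def matrix_matrix_mult_def if_distrib[of "\<lambda>c. c * _"] cong: if_cong)
    have tU: "transpose U = U"
      by (auto simp: U_def transpose_def vec_eq_iff)
    have XU: "(X ** U) $ a $ b = (if b = i then - 1 else 1) * X $ a $ b" for X :: "real^'n^'n" and a b
      by (simp add: U_def matrix_matrix_mult_def if_distrib[of "\<lambda>c. _ * c"] cong: if_cong)
    have "orthogonal_matrix U"
      unfolding orthogonal_matrix_def tU by (simp add: vec_eq_iff UX) (simp add: U_def mat_def)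
    from assms[OF this] have "(U ** G ** U) $ i $ j = G $ i $ j"
      by (simp add: tU)
    then show ?thesis
      using that by (simp add: UX XU)
  qed
  have diag: "G $ i $ i = G $ j $ j" for i j
  proof -
    \<comment> \<open>This is the permutation exchanging i and j, not a matrix transpose.\<close>
    define \<sigma> where "\<sigma> = Transposition.transpose i j"
    have \<sigma>: "\<sigma> (\<sigma> a) = a" for a
      by (simp add: \<sigma>_def)
    define U :: "real^'n^'n" where "U = (\<chi> a b. if b = \<sigma> a then 1 else 0)"
    have UX: "(U ** X) $ a $ b = X $ (\<sigma> a) $ b" for X :: "real^'n^'n" and a b
      by (simp add: U_def matrix_matrix_mult_def if_distrib[of "\<lambda>c. c * _"] cong: if_cong)
    have tU: "transpose U = U"
      using \<sigma> by (auto simp: U_def transpose_def vec_eq_iff)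
    have XU: "(X ** U) $ a $ b = X $ a $ (\<sigma> b)" for X :: "real^'n^'n" and a b
      using arg_cong[OF matrix_transpose_mul[of X U], of "\<lambda>M. M $ b $ a"]
      by (simp add: tU UX) (simp add: transpose_def)
    have "orthogonal_matrix U"
      unfolding orthogonal_matrix_def tU using \<sigma> by (simp add: vec_eq_iff UX) (simp add: U_def mat_def)
    from assms[OF this] have "(U ** G ** U) $ i $ i = G $ i $ i"
      by (simp add: tU)
    then show ?thesis
      by (simp add: UX XU \<sigma>_def)
  qed
  have "G = (G $ undefined $ undefined) *\<^sub>R mat 1"
    using off diag by (auto simp: vec_eq_iff mat_def)
  then show ?thesis
    by (rule that)
qed

section \<open>Gram matrices and the Lyapunov form of the condition\<close>

context
  fixes A :: "complex^'n^'n" and R :: "real^'n^'n"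
  assumes R_def: "R = mRe (A ** adjoint_mat A)"
begin

text \<open>Re (z * cnj w) is the inner product of the complex plane, so R is a real Gram
  matrix.\<close>

lemma mRe_gram_entry: "R $ i $ j = (\<Sum>l\<in>UNIV. A $ i $ l \<bullet> A $ j $ l)"
  by (simp add: R_def mRe_def matrix_matrix_mult_def adjoint_mat_def mconj_def transpose_def inner_complex_def)

text \<open>The quadratic form is a sum of squares of the vectors y; if it vanishes then R x = 0,
  and full rank gives x = 0.\<close>

lemma mRe_gram_pos_def:
  assumes "rank R = CARD('n)"
  shows "pos_def R"
proof -
  define y where "y x l = (\<Sum>i\<in>UNIV. x $ i *\<^sub>R A $ i $ l)" for x :: "real^'n" and l
  have Rx: "(R *v x) $ i = (\<Sum>l\<in>UNIV. A $ i $ l \<bullet> y x l)" for x i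
    unfolding matrix_vector_mult_def vec_lambda_beta mRe_gram_entry y_def inner_sum_right sum_distrib_right
    by (subst sum.swap) (simp add: mult.commute)
  have xRx: "x \<bullet> (R *v x) = (\<Sum>l\<in>UNIV. y x l \<bullet> y x l)" for x
    unfolding inner_vec_def[of x] Rx inner_real_def sum_distrib_left
    by (subst sum.swap) (simp add: y_def inner_sum_left[of _ UNIV "y x _"] inner_sum_left)
  have "0 < x \<bullet> (R *v x)" if "x \<noteq> 0" for x
  proof -
    have "x \<bullet> (R *v x) \<noteq> 0"
    proof
      assume "x \<bullet> (R *v x) = 0"
      then have "y x l = 0" for l
        unfolding xRx by (subst (asm) sum_nonneg_eq_0_iff) auto
      then have "R *v x = R *v 0"
        by (simp add: vec_eq_iff Rx)
      moreover have "inj ((*v) R)"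
        using assms full_rank_injective by blast
      ultimately show False
        using that by (meson injD)
    qed
    moreover have "0 \<le> x \<bullet> (R *v x)"
      unfolding xRx by (intro sum_nonneg) simp
    ultimately show ?thesis by simp
  qed
  moreover have "transpose R = R"
    by (simp add: vec_eq_iff transpose_def mRe_gram_entry inner_commute)
  ultimately show ?thesis
    by (simp add: pos_def_def)
qed

end

text \<open>A Hermitian matrix has a real diagonal. So if its imaginary part is proportional to a
  matrix with positive diagonal, that part is 0.\<close>

lemma mIm_gram_diag: "mIm (A ** adjoint_mat A) $ k $ k = 0"
  by (simp add: mIm_def matrix_matrix_mult_def adjoint_mat_def mconj_def transpose_def)

lemma neg_diff_eq_diff_iff: "- (a - c) = b - c \<longleftrightarrow> a + b = c + c" for a b c :: "'a::ab_group_add"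
proof -
  have *: "(b - c) + a = (a + b) - c"
    by simp
  have "- (a - c) = b - c \<longleftrightarrow> c = (a + b) - c"
    unfolding minus_diff_eq diff_eq_eq[of c a "b - c"] * ..
  also have "\<dots> \<longleftrightarrow> a + b = c + c"
    unfolding eq_diff_eq by (rule eq_commute)
  finally show ?thesis .
qed

text \<open>Expanding both products, the condition is the eigenvector equation of the Lyapunov
  operator, the form used throughout the proof.\<close>

lemma similarity_condition_iff:
  fixes D R :: "real^'n^'n"
  shows "- ((D - d *\<^sub>R mat 1) ** R) = R ** (transpose D - d *\<^sub>R mat 1)
    \<longleftrightarrow> D ** R + R ** transpose D = (2 * d) *\<^sub>R R"
proof -
  have 1: "(D - d *\<^sub>R mat 1) ** R = D ** R - d *\<^sub>R R"
    using matrix_add_rdistrib[of D "- d *\<^sub>R mat 1" R] scaleR_matrix_mult[of "- d" "mat 1" R] by simp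
  have 2: "R ** (transpose D - d *\<^sub>R mat 1) = R ** transpose D - d *\<^sub>R R"
    using matrix_add_ldistrib[of R "transpose D" "- d *\<^sub>R mat 1"] matrix_mult_scaleR[of R "- d" "mat 1"] by simp
  have 3: "(2 * d) *\<^sub>R R = d *\<^sub>R R + d *\<^sub>R R"
    by (subst mult_2) (rule scaleR_left_distrib)
  show ?thesis
    unfolding 1 2 3 by (rule neg_diff_eq_diff_iff)
qed

section \<open>Isotropic spectral densities\<close>

lemma isotropic_spectral_matrix:
  fixes D :: "real^'n^'n" and A :: "complex^'n^'n"
  defines "Q \<equiv> A ** adjoint_mat A"
  assumes im: "mIm Q = 0" and comm: "D ** mRe Q + mRe Q ** transpose D = (2 * d) *\<^sub>R mRe Q"
    and x: "x \<noteq> 0"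
  shows "spectral_matrix D A x $ i $ j = of_real (\<bar>x\<bar> powr (- 2 * d) * mRe Q $ i $ j)"
proof -
  \<comment> \<open>Q is real, so conjugation on the negative half-line has no effect and one
    formula covers both signs of x.\<close>
  have Q: "Q $ k $ l = of_real (mRe Q $ k $ l)" for k l
    using im by (simp add: vec_eq_iff mIm_def mRe_def complex_eq_iff)
  let ?E = "mexp ((- ln \<bar>x\<bar>) *\<^sub>R D)"
  have "spectral_matrix D A x $ i $ j
      = (\<Sum>l\<in>UNIV. \<Sum>k\<in>UNIV. of_real (?E $ i $ k * ?E $ j $ l * mRe Q $ k $ l))"
    unfolding spectral_matrix_entry[OF x] Q_def[symmetric]
    by (intro sum.cong refl) (simp add: Q)
  also have "\<dots> = of_real ((?E ** mRe Q ** transpose ?E) $ i $ j)"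
    unfolding congruence_entry by simp
  also have "\<dots> = of_real (exp (2 * d * (- ln \<bar>x\<bar>)) * mRe Q $ i $ j)"
    unfolding mexp_congruence_eq[OF comm] by simp
  also have "exp (2 * d * (- ln \<bar>x\<bar>)) = \<bar>x\<bar> powr (- 2 * d)"
    using x by (simp add: powr_def)
  finally show ?thesis .
qed

text \<open>A positive diagonal entry of the density is exactly a multiple of |x|^(-2d); comparing
  it with \<open>spectral_matrix_bound\<close> as x tends to 0 or infinity gives |d| <= b.\<close>

lemma isotropic_exponent_bound:
  fixes D :: "real^'n^'n" and A :: "complex^'n^'n"
  defines "Q \<equiv> A ** adjoint_mat A"
  assumes roots: "\<forall>z\<in>char_roots D. - 1/2 < Re z \<and> Re z < 1/2"
    and pos: "pos_def (mRe Q)" and im: "mIm Q = 0"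
    and comm: "D ** mRe Q + mRe Q ** transpose D = (2 * d) *\<^sub>R mRe Q"
  shows "\<bar>d\<bar> < 1/2"
proof -
  obtain b K where b: "0 \<le> b" "b < 1/2" "0 \<le> K"
    and K: "\<And>x i j. x \<noteq> 0 \<Longrightarrow> cmod (spectral_matrix D A x $ i $ j) \<le> K * exp (2 * b * \<bar>ln \<bar>x\<bar>\<bar>)"
    using spectral_matrix_bound[OF roots] by metis
  define r where "r = mRe Q $ undefined $ undefined"
  have r: "r > 0"
    unfolding r_def by (rule pos_def_diag[OF pos])
  have bound: "exp (2 * d * s) * r \<le> K * exp (2 * b * \<bar>s\<bar>)" for s
    using K[of "exp (- s)" undefined undefined] r
      isotropic_spectral_matrix[OF im[unfolded Q_def] comm[unfolded Q_def], of "exp (- s)" undefined undefined, folded Q_def]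
    by (simp add: r_def[symmetric] powr_def abs_mult norm_mult)
  have "\<bar>d\<bar> \<le> b"
  proof (rule ccontr)
    assume "\<not> \<bar>d\<bar> \<le> b"
    \<comment> \<open>Chosen so that the excess exponent 2(|d| - b)t equals K/r; the bound then
      reads exp u <= u for u = K/r, which is absurd. The sign of d selects the end of the
      half-line.\<close>
    define t where "t = K / r / (2 * (\<bar>d\<bar> - b))"
    have t: "t \<ge> 0" "2 * (\<bar>d\<bar> - b) * t = K / r"
      using \<open>\<not> \<bar>d\<bar> \<le> b\<close> b r by (auto simp: t_def)
    have "d * (sgn d * t) = \<bar>d\<bar> * t" "\<bar>sgn d * t\<bar> \<le> t"
      using t(1) by (simp_all add: abs_mult sgn_if flip: mult.assoc)
    have "exp (2 * \<bar>d\<bar> * t) * r \<le> K * exp (2 * b * \<bar>sgn d * t\<bar>)"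
      using bound[of "sgn d * t"] \<open>d * (sgn d * t) = \<bar>d\<bar> * t\<close> by (simp add: mult.assoc)
    also have "\<dots> \<le> K * exp (2 * b * t)"
      using b \<open>\<bar>sgn d * t\<bar> \<le> t\<close> by (intro mult_left_mono) (auto intro: mult_left_mono)
    finally have "exp (2 * \<bar>d\<bar> * t) / exp (2 * b * t) \<le> K / r"
      using r by (simp add: field_simps)
    then have "exp (K / r) \<le> K / r"
      using t(2) by (simp add: algebra_simps flip: exp_diff)
    then show False
      using exp_ge_add_one_self[of "K / r"] by linarith
  qed
  with b show ?thesis by simp
qed

lemma isotropic_cov:
  fixes D :: "real^'n^'n" and A :: "complex^'n^'n"
  defines "Q \<equiv> A ** adjoint_mat A"
  assumes roots: "\<forall>z\<in>char_roots D. - 1/2 < Re z \<and> Re z < 1/2"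
    and pos: "pos_def (mRe Q)" and im: "mIm Q = 0"
    and comm: "D ** mRe Q + mRe Q ** transpose D = (2 * d) *\<^sub>R mRe Q"
  obtains c where "c > 0"
    "\<And>t s. mRe (ofbm_cov D A t s) = (c / 2
      * (\<bar>t\<bar> powr (2 * (d + 1/2)) + \<bar>s\<bar> powr (2 * (d + 1/2)) - \<bar>t - s\<bar> powr (2 * (d + 1/2)))) *\<^sub>R mRe Q"
proof -
  note spec = isotropic_spectral_matrix[OF im[unfolded Q_def] comm[unfolded Q_def], folded Q_def]
  have integrand: "ofbm_transfer t x * cnj (ofbm_transfer s x) * spectral_matrix D A x $ i $ j
      = ofbm_transfer t x * cnj (ofbm_transfer s x) * of_real (\<bar>x\<bar> powr (- 2 * d) * mRe Q $ i $ j)" for t s x i j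
    by (cases "x = 0") (simp_all add: spec)
  have Re_integrand: "Re (ofbm_transfer t x * cnj (ofbm_transfer s x) * spectral_matrix D A x $ i $ j)
      = Re (ofbm_transfer t x * cnj (ofbm_transfer s x)) * \<bar>x\<bar> powr (- 2 * d) * mRe Q $ i $ j" for t s x i j
  proof -
    have "Re (z * of_real (p * q)) = Re z * p * q" for z p q
      by simp
    then show ?thesis
      unfolding integrand .
  qed
  have int: "integrable lborel (\<lambda>x. (cmod (ofbm_transfer t x))\<^sup>2 * \<bar>x\<bar> powr (- 2 * d))" for t
  proof -
    \<comment> \<open>A diagonal entry of the OFBM integrand is r > 0 times the scalar one, so
      integrability is inherited after dividing by r.\<close>
    define r where "r = mRe Q $ undefined $ undefined"
    have r: "r > 0"
      unfolding r_def by (rule pos_def_diag[OF pos])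
    have "integrable lborel (\<lambda>x. Re (ofbm_transfer t x * cnj (ofbm_transfer t x) * spectral_matrix D A x $ undefined $ undefined))"
      using ofbm_integrand_integrable[OF roots] by (intro integrable_Re)
    moreover have "Re (z * cnj z) = (cmod z)\<^sup>2" for z
      unfolding cmod_power2 by (simp add: power2_eq_square)
    ultimately have "integrable lborel (\<lambda>x. (cmod (ofbm_transfer t x))\<^sup>2 * \<bar>x\<bar> powr (- 2 * d) * r)"
      unfolding Re_integrand r_def by (simp only:)
    then show ?thesis
      using r by simp
  qed
  show ?thesis
  proof (rule that[OF fbm_density_integral_pos[OF int]])
    fix t s
    have "Re (ofbm_cov D A t s $ i $ j) = fbm_density_integral d 1 / 2
      * (\<bar>t\<bar> powr (2 * (d + 1/2)) + \<bar>s\<bar> powr (2 * (d + 1/2)) - \<bar>t - s\<bar> powr (2 * (d + 1/2))) * mRe Q $ i $ j" for i j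
    proof -
      have "Re (ofbm_cov D A t s $ i $ j)
          = (LBINT x. Re (ofbm_transfer t x * cnj (ofbm_transfer s x) * spectral_matrix D A x $ i $ j))"
        unfolding ofbm_cov_def vec_lambda_beta
        by (rule integral_Re[OF ofbm_integrand_integrable[OF roots], symmetric])
      also have "\<dots> = (LBINT x. Re (ofbm_transfer t x * cnj (ofbm_transfer s x)) * \<bar>x\<bar> powr (- 2 * d)) * mRe Q $ i $ j"
        unfolding Re_integrand by (rule integral_mult_left_zero)
      finally show ?thesis
        unfolding fbm_cov_integral[OF int] .
    qed
    then show "mRe (ofbm_cov D A t s) = (fbm_density_integral d 1 / 2
      * (\<bar>t\<bar> powr (2 * (d + 1/2)) + \<bar>s\<bar> powr (2 * (d + 1/2)) - \<bar>t - s\<bar> powr (2 * (d + 1/2)))) *\<^sub>R mRe Q"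
      by (simp add: vec_eq_iff mRe_def[of "ofbm_cov D A t s"])
  qed
qed

section \<open>From covariances back to the spectral density\<close>

text \<open>Subtracting covariances at times t and t + 1 against time 1 gives the Fourier transform
  of |f_1|^2 u, where f_1 is the transfer function at time 1 and u the defect of the relation. As
  f_1 has no zero in (0,pi), u vanishes almost everywhere on (0,2).\<close>

lemma proportional_cov_spectral_AE:
  fixes D :: "real^'n^'n" and A :: "complex^'n^'n"
  assumes roots: "\<forall>z\<in>char_roots D. - 1/2 < Re z \<and> Re z < 1/2"
    and proportional: "\<And>t s. p * ofbm_cov D A t s $ i $ j = q * ofbm_cov D A t s $ k $ l"
  shows "AE x in lborel. x \<in> {0<..<2} \<longrightarrow> p * spectral_matrix D A x $ i $ j = q * spectral_matrix D A x $ k $ l"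
proof -
  define u where "u x = p * spectral_matrix D A x $ i $ j - q * spectral_matrix D A x $ k $ l" for x
  define w where "w x = ofbm_transfer 1 x * cnj (ofbm_transfer 1 x) * u x" for x
  have u_split: "ofbm_transfer t x * cnj (ofbm_transfer s x) * u x
      = p * (ofbm_transfer t x * cnj (ofbm_transfer s x) * spectral_matrix D A x $ i $ j)
        - q * (ofbm_transfer t x * cnj (ofbm_transfer s x) * spectral_matrix D A x $ k $ l)" for t s x
    by (simp add: u_def algebra_simps)
  have int: "integrable lborel (\<lambda>x. ofbm_transfer t x * cnj (ofbm_transfer s x) * u x)" for t s
    unfolding u_split using ofbm_integrand_integrable[OF roots]
    by (intro Bochner_Integration.integrable_diff integrable_mult_right)
  have zero: "(CLBINT x. ofbm_transfer t x * cnj (ofbm_transfer s x) * u x) = 0" for t s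
    unfolding u_split using ofbm_integrand_integrable[OF roots] proportional[of t s]
    by (simp add: ofbm_cov_def)
  have "AE x in lborel. w x = 0"
  proof (rule fourier_injective)
    show "integrable lborel w"
      unfolding w_def by (rule int)
    fix t
    have "w x * iexp (t * x) = ofbm_transfer (t + 1) x * cnj (ofbm_transfer 1 x) * u x
        - ofbm_transfer t x * cnj (ofbm_transfer 1 x) * u x" for x
      unfolding w_def left_diff_distrib[symmetric] ofbm_transfer_shift by (simp only: ac_simps)
    then show "(CLBINT x. w x * iexp (t * x)) = 0"
      using int by (simp only: Bochner_Integration.integral_diff zero) simp
  qed
  then show ?thesis
  proof eventually_elim
    case (elim x)
    then show ?case
      using ofbm_transfer_1_nonzero[of x] pi_gt3 by (auto simp: w_def u_def)
  qed
qed

lemma mexp_congruence_proportional: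
  fixes D R :: "real^'n^'n"
  defines "F \<equiv> \<lambda>s. mexp (s *\<^sub>R D) ** R ** transpose (mexp (s *\<^sub>R D))"
  assumes ae: "AE x in lborel. x \<in> {0<..<2} \<longrightarrow> p * F (- ln x) $ i $ j = q * F (- ln x) $ k $ l"
  shows "p * R $ i $ j = q * R $ k $ l"
    and "p * (D ** R + R ** transpose D) $ i $ j = q * (D ** R + R ** transpose D) $ k $ l"
proof -
  define v where "v s = p * F s $ i $ j - q * F s $ k $ l" for s
  define R' where "R' = D ** R + R ** transpose D"
  define v' where "v' s = p * (mexp (s *\<^sub>R D) ** R' ** transpose (mexp (s *\<^sub>R D))) $ i $ j
      - q * (mexp (s *\<^sub>R D) ** R' ** transpose (mexp (s *\<^sub>R D))) $ k $ l" for s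
  have deriv: "(v has_real_derivative v' s) (at s)" for s
    unfolding v_def v'_def F_def R'_def
    by (intro DERIV_diff DERIV_cmult mexp_congruence_has_derivative)
  have "continuous_on UNIV v"
    using deriv DERIV_isCont by (intro continuous_at_imp_continuous_on) blast
  then have "continuous_on {0<..<2} (\<lambda>x. v (- ln x))"
    by (rule continuous_on_compose2) (auto intro!: continuous_intros)
  moreover have "AE x in lborel. x \<in> {0<..<2} \<longrightarrow> v (- ln x) = 0"
    using ae by eventually_elim (simp add: v_def)
  ultimately have "v (- ln x) = 0" if "x \<in> {0<..<2}" for x
    using that AE_zero_continuous_imp_zero by blast
  \<comment> \<open>x in (0,2) means s = -ln x > -ln 2, an open set around s = 0, so the derivative
    at 0 vanishes along with the value.\<close>
  then have zero: "v s = 0" if "- ln 2 < s" for s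
  proof -
    have "exp (- s) < 2"
      using that by (metis exp_less_mono exp_ln minus_less_iff zero_less_numeral)
    then show ?thesis
      using \<open>\<And>x. x \<in> {0<..<2} \<Longrightarrow> v (- ln x) = 0\<close>[of "exp (- s)"] by simp
  qed
  have "((\<lambda>_. 0) has_real_derivative v' 0) (at 0)"
    by (rule has_field_derivative_transform_within_open[OF deriv, where S = "{- ln 2<..}"]) (use zero in auto)
  then have "v' 0 = 0"
    using DERIV_unique DERIV_const by blast
  then show "p * (D ** R + R ** transpose D) $ i $ j = q * (D ** R + R ** transpose D) $ k $ l"
    unfolding v'_def mexp_zero by (simp add: R'_def transpose_mat)
  have "v 0 = 0"
    by (rule zero) simp
  then show "p * R $ i $ j = q * R $ k $ l"
    unfolding v_def F_def mexp_zero by (simp add: transpose_mat)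
qed

lemma proportional_cov_imp_isotropic:
  fixes D :: "real^'n^'n" and A :: "complex^'n^'n"
  defines "Q \<equiv> A ** adjoint_mat A"
  assumes roots: "\<forall>z\<in>char_roots D. - 1/2 < Re z \<and> Re z < 1/2"
    and pos: "pos_def (mRe Q)" and P: "pos_def P"
    and proportional: "\<And>t s. \<exists>g. ofbm_cov D A t s = cmat (g *\<^sub>R P)"
  obtains d where "mIm Q = 0" "D ** mRe Q + mRe Q ** transpose D = (2 * d) *\<^sub>R mRe Q"
proof -
  define k :: 'n where "k = undefined"
  have p: "P $ k $ k > 0" and r: "mRe Q $ k $ k > 0"
    using pos_def_diag P pos by auto
  \<comment> \<open>Multiplying crosswise with the (k,k) entries removes the unknown scalar g, which
    depends on t and s.\<close>
  have "of_real (P $ k $ k) * ofbm_cov D A t s $ i $ j = of_real (P $ i $ j) * ofbm_cov D A t s $ k $ k" for t s i j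
  proof -
    obtain g where "ofbm_cov D A t s = cmat (g *\<^sub>R P)"
      using proportional by blast
    then show ?thesis
      by (simp add: cmat_def)
  qed
  then have ae: "AE x in lborel. x \<in> {0<..<2} \<longrightarrow>
      of_real (P $ k $ k) * spectral_matrix D A x $ i $ j = of_real (P $ i $ j) * spectral_matrix D A x $ k $ k" for i j
    by (rule proportional_cov_spectral_AE[OF roots])
  have re: "P $ k $ k * mRe Q $ i $ j = P $ i $ j * mRe Q $ k $ k"
    "P $ k $ k * (D ** mRe Q + mRe Q ** transpose D) $ i $ j
      = P $ i $ j * (D ** mRe Q + mRe Q ** transpose D) $ k $ k" for i j
  proof -
    have "AE x in lborel. x \<in> {0<..<2} \<longrightarrow>
        P $ k $ k * (mexp ((- ln x) *\<^sub>R D) ** mRe Q ** transpose (mexp ((- ln x) *\<^sub>R D))) $ i $ j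
        = P $ i $ j * (mexp ((- ln x) *\<^sub>R D) ** mRe Q ** transpose (mexp ((- ln x) *\<^sub>R D))) $ k $ k"
      using ae[of i j] unfolding Q_def
    proof eventually_elim
      case (elim x)
      show ?case
      proof
        assume x: "x \<in> {0<..<2}"
        then have "0 < x" by simp
        then show "P $ k $ k * (mexp ((- ln x) *\<^sub>R D) ** mRe (A ** adjoint_mat A)
              ** transpose (mexp ((- ln x) *\<^sub>R D))) $ i $ j
            = P $ i $ j * (mexp ((- ln x) *\<^sub>R D) ** mRe (A ** adjoint_mat A)
              ** transpose (mexp ((- ln x) *\<^sub>R D))) $ k $ k"
          using arg_cong[OF elim[rule_format, OF x], of Re]
          unfolding spectral_matrix_Re_Im(1)[OF \<open>0 < x\<close>, symmetric] by simp
      qed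
    qed
    from mexp_congruence_proportional[OF this]
    show "P $ k $ k * mRe Q $ i $ j = P $ i $ j * mRe Q $ k $ k"
      "P $ k $ k * (D ** mRe Q + mRe Q ** transpose D) $ i $ j
        = P $ i $ j * (D ** mRe Q + mRe Q ** transpose D) $ k $ k"
      by auto
  qed
  have im: "P $ k $ k * mIm Q $ i $ j = P $ i $ j * mIm Q $ k $ k" for i j
  proof -
    have "AE x in lborel. x \<in> {0<..<2} \<longrightarrow>
        P $ k $ k * (mexp ((- ln x) *\<^sub>R D) ** mIm Q ** transpose (mexp ((- ln x) *\<^sub>R D))) $ i $ j
        = P $ i $ j * (mexp ((- ln x) *\<^sub>R D) ** mIm Q ** transpose (mexp ((- ln x) *\<^sub>R D))) $ k $ k"
      using ae[of i j] unfolding Q_def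
    proof eventually_elim
      case (elim x)
      show ?case
      proof
        assume x: "x \<in> {0<..<2}"
        then have "0 < x" by simp
        then show "P $ k $ k * (mexp ((- ln x) *\<^sub>R D) ** mIm (A ** adjoint_mat A)
              ** transpose (mexp ((- ln x) *\<^sub>R D))) $ i $ j
            = P $ i $ j * (mexp ((- ln x) *\<^sub>R D) ** mIm (A ** adjoint_mat A)
              ** transpose (mexp ((- ln x) *\<^sub>R D))) $ k $ k"
          using arg_cong[OF elim[rule_format, OF x], of Im]
          unfolding spectral_matrix_Re_Im(2)[OF \<open>0 < x\<close>, symmetric] by simp
      qed
    qed
    from mexp_congruence_proportional(1)[OF this] show ?thesis .
  qed
  have "mIm Q = 0"
    using im p mIm_gram_diag[of A k] by (simp add: vec_eq_iff Q_def)
  \<comment> \<open>Both Re Q and its Lyapunov image are proportional to P, the former with a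
    nonzero factor; hence the image is \<open>\<mu>\<close> times Re Q, and d = \<open>\<mu>\<close>
    / 2.\<close>
  moreover define \<mu> where "\<mu> = (D ** mRe Q + mRe Q ** transpose D) $ k $ k / mRe Q $ k $ k"
  have "(D ** mRe Q + mRe Q ** transpose D) $ i $ j = \<mu> * mRe Q $ i $ j" for i j
  proof -
    have "P $ k $ k * (mRe Q $ k $ k * (D ** mRe Q + mRe Q ** transpose D) $ i $ j)
        = mRe Q $ k $ k * (P $ i $ j * (D ** mRe Q + mRe Q ** transpose D) $ k $ k)"
      by (subst mult.left_commute) (simp only: re(2)[of i j])
    also have "\<dots> = P $ k $ k * (mRe Q $ i $ j * (D ** mRe Q + mRe Q ** transpose D) $ k $ k)"
      using re(1)[of i j] by (simp only: mult.assoc[symmetric]) (simp only: mult.commute)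
    finally have eq: "mRe Q $ k $ k * (D ** mRe Q + mRe Q ** transpose D) $ i $ j
        = mRe Q $ i $ j * (D ** mRe Q + mRe Q ** transpose D) $ k $ k"
      by (rule mult_left_cancel[THEN iffD1, rotated]) (use p in simp)
    have "a = m / b * q" if "b * a = q * m" "b \<noteq> 0" for a b m q :: real
      using that by (simp add: field_simps)
    from this[OF eq] r show ?thesis
      by (simp only: \<mu>_def)
  qed
  then have "D ** mRe Q + mRe Q ** transpose D = (2 * (\<mu> / 2)) *\<^sub>R mRe Q"
    by (simp add: vec_eq_iff)
  ultimately show ?thesis
    by (rule that)
qed

section \<open>The symmetry group of an OFBM\<close>

lemma cov_matrix_ofbm:
  assumes "is_ofbm M D A B"
  shows "ofbm_cov D A t s = cmat (cov_matrix M B t s)"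
  using assms by (simp add: is_ofbm_def cov_matrix_def cmat_def vec_eq_iff)

lemma symmetry_group_eq:
  assumes "prob_space M" "centered_gaussian_process M B"
  shows "symmetry_group M B
    = {C. invertible C \<and> (\<forall>t s. C ** cov_matrix M B t s ** transpose C = cov_matrix M B t s)}"
  unfolding symmetry_group_def
    fdd_eq_iff_cov_matrix[OF assms(1,1) gaussian_process_linear_image[OF assms] assms(2)]
    cov_matrix_linear_image[OF assms] ..

theorem theorem5p1:
  fixes M :: "'a measure"
    and D :: "real^'n^'n" and A :: "complex^'n^'n"
    and B :: "real \<Rightarrow> 'a \<Rightarrow> real^'n"
  assumes "prob_space M"
    and "\<forall>z \<in> char_roots D. - 1/2 < Re z \<and> Re z < 1/2"
    and "rank (mRe (A ** adjoint_mat A)) = CARD('n)"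
    and "is_ofbm M D A B"
  shows "(maximal_type M B \<longleftrightarrow>
            (\<exists>d::real. mIm (A ** adjoint_mat A) = 0 \<and>
               - ((D - d *\<^sub>R mat 1) ** mRe (A ** adjoint_mat A))
                 = mRe (A ** adjoint_mat A) ** (transpose D - d *\<^sub>R mat 1)))
       \<and> (maximal_type M B \<longrightarrow>
            (\<exists>W (N :: 'a measure) X. pos_def W \<and> prob_space N \<and> is_single_param_ofbm N X \<and>
               fdd_eq M B N (\<lambda>t \<omega>. W *v X t \<omega>)))"
proof -
  define R where "R = mRe (A ** adjoint_mat A)"
  let ?isotropic = "\<lambda>d. mIm (A ** adjoint_mat A) = 0 \<and> D ** R + R ** transpose D = (2 * d) *\<^sub>R R"
  note M = assms(1) and roots = assms(2)
  have B: "centered_gaussian_process M B"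
    using assms(4) by (simp add: is_ofbm_def)
  have cov: "ofbm_cov D A t s = cmat (cov_matrix M B t s)" for t s
    by (rule cov_matrix_ofbm[OF assms(4)])
  have pos: "pos_def R"
    using mRe_gram_pos_def[OF R_def] assms(3) by (simp add: R_def)
  \<comment> \<open>This square root serves twice: as the conjugating matrix in the maximal type and
    as the change of coordinates to a single parameter process.\<close>
  obtain W where W: "pos_def W" "W ** W = R"
    using pos_def_sqrt[OF pos] .
  have isotropic: "maximal_type M B \<and> (\<exists>W (N :: 'a measure) X. pos_def W \<and> prob_space N \<and> is_single_param_ofbm N X \<and>
      fdd_eq M B N (\<lambda>t \<omega>. W *v X t \<omega>))" if iso: "?isotropic d" for d
  proof
    define \<rho> where "\<rho> t s = \<bar>t\<bar> powr (2 * (d + 1/2)) + \<bar>s\<bar> powr (2 * (d + 1/2)) - \<bar>t - s\<bar> powr (2 * (d + 1/2))" for t s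
    have d: "\<bar>d\<bar> < 1/2"
      using isotropic_exponent_bound[OF roots] pos iso by (simp add: R_def)
    obtain c where c: "c > 0" "\<And>t s. mRe (ofbm_cov D A t s) = (c / 2 * \<rho> t s) *\<^sub>R R"
      using isotropic_cov[OF roots, of A d] pos iso unfolding R_def \<rho>_def by metis
    have cov_R: "cov_matrix M B t s = (c / 2 * \<rho> t s) *\<^sub>R R" for t s
      using c(2)[of t s] unfolding cov by (simp add: cmat_def mRe_def)
    \<comment> \<open>At t = s = 1 the covariance is c R with c > 0, so invariance of this one
      matrix already gives invariance of R.\<close>
    have "\<rho> 1 1 = 2"
      by (simp add: \<rho>_def)
    have "(\<forall>t s. C ** cov_matrix M B t s ** transpose C = cov_matrix M B t s) \<longleftrightarrow> C ** R ** transpose C = R" for C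
    proof
      assume "\<forall>t s. C ** cov_matrix M B t s ** transpose C = cov_matrix M B t s"
      then have "C ** cov_matrix M B 1 1 ** transpose C = cov_matrix M B 1 1"
        by blast
      then show "C ** R ** transpose C = R"
        using c(1) \<open>\<rho> 1 1 = 2\<close> by (simp add: cov_R matrix_mult_scaleR scaleR_matrix_mult)
    qed (simp add: cov_R matrix_mult_scaleR scaleR_matrix_mult)
    then show "maximal_type M B"
      unfolding maximal_type_def symmetry_group_eq[OF M B]
      using W congruence_stabilizer_eq[OF W(1)] by auto
    \<comment> \<open>Undoing W turns the matrix R in the covariance into the identity; the process
      X lives on the same probability space and W X is B itself.\<close>
    define V where "V = matrix_inv W"
    note WV = pos_def_inverse[OF W(1), folded V_def]
    define X where "X t \<omega> = V *v B t \<omega>" for t \<omega>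
    have X: "centered_gaussian_process M X"
      unfolding X_def by (rule gaussian_process_linear_image[OF M B])
    have "V ** R ** transpose V = mat 1"
      unfolding W(2)[symmetric] WV(3) by (simp add: matrix_mul_assoc WV(2)) (simp add: WV)
    then have cov_X: "cov_matrix M X t s = (c / 2 * \<rho> t s) *\<^sub>R mat 1" for t s
      unfolding X_def cov_matrix_linear_image[OF M B] cov_R
      by (simp add: matrix_mult_scaleR scaleR_matrix_mult)
    have "(LINT \<omega>|M. X t \<omega> $ i * X s \<omega> $ j) = (if i = j then c / 2 * \<rho> t s else 0)" for t s i j
      using arg_cong[OF cov_X[of t s], of "\<lambda>G. G $ i $ j"] by (simp add: cov_matrix_def mat_def split: if_splits)
    then have "is_single_param_ofbm M X"
      unfolding is_single_param_ofbm_def \<rho>_def using X c(1) d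
      by (intro conjI exI[of _ "d + 1/2"] exI[of _ c]) auto
    moreover have "(\<lambda>t \<omega>. W *v X t \<omega>) = B"
      by (simp add: X_def fun_eq_iff matrix_vector_mul_assoc WV)
    ultimately show "\<exists>W (N :: 'a measure) X. pos_def W \<and> prob_space N \<and> is_single_param_ofbm N X \<and>
        fdd_eq M B N (\<lambda>t \<omega>. W *v X t \<omega>)"
      using W(1) M by (intro exI[of _ W] exI[of _ M] exI[of _ X]) (simp add: fdd_eq_def)
  qed
  have "\<exists>d. ?isotropic d" if max: "maximal_type M B"
  proof -
    \<comment> \<open>This W comes from the maximal type and is not the square root of R chosen
      above.\<close>
    obtain W where W: "pos_def W" and sym: "symmetry_group M B = {W ** U ** matrix_inv W | U. orthogonal_matrix U}"
      using max by (auto simp: maximal_type_def)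
    define V where "V = matrix_inv W"
    note WV = pos_def_inverse[OF W, folded V_def]
    have tW: "transpose W = W"
      using W by (simp add: pos_def_def)
    have VWX: "V ** (W ** X) = X" "W ** (V ** X) = X" for X :: "real^'n^'n"
      by (simp_all add: matrix_mul_assoc WV)
    have "\<exists>g. ofbm_cov D A t s = cmat (g *\<^sub>R (W ** W))" for t s
    proof -
      \<comment> \<open>Passing to the coordinates of W turns invariance under the conjugated group
        into invariance under the orthogonal group itself.\<close>
      define G where "G = V ** cov_matrix M B t s ** V"
      have "U ** G ** transpose U = G" if "orthogonal_matrix U" for U
      proof -
        have "W ** U ** V \<in> symmetry_group M B"
          unfolding sym V_def using that by blast
        then have "W ** U ** V ** cov_matrix M B t s ** transpose (W ** U ** V) = cov_matrix M B t s"
          unfolding symmetry_group_eq[OF M B] by blast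
        then have "V ** (W ** U ** V ** cov_matrix M B t s ** transpose (W ** U ** V)) ** V = G"
          by (simp add: G_def)
        then show ?thesis
          by (simp add: G_def matrix_transpose_mul tW WV VWX matrix_mul_assoc[symmetric])
      qed
      then obtain g where "G = g *\<^sub>R mat 1"
        using orthogonal_invariant_scalar by metis
      then have "W ** G ** W = g *\<^sub>R (W ** W)"
        by (simp add: matrix_mult_scaleR scaleR_matrix_mult)
      moreover have "W ** G ** W = cov_matrix M B t s"
        by (simp add: G_def WV VWX matrix_mul_assoc[symmetric])
      ultimately show ?thesis
        unfolding cov by metis
    qed
    then show ?thesis
      using proportional_cov_imp_isotropic[OF roots, of A "W ** W"] pos pos_def_square[OF W]
      unfolding R_def by metis
  qed
  then show ?thesis
    unfolding similarity_condition_iff R_def[symmetric] using isotropic by blast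
qed

end
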